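(* Let $\lambda\in(1/2,1)$ be such that $\lambda^{-1}$ is a Garsia number. Then for any $h:\mathbb{N}\to [0,\infty)$ satisfying $\sum_{n=1}^{\infty}h(n)=\infty$, Lebesgue almost every $x\in [0,\frac{1}{1-\lambda}]$ is contained in $R(S_{\lambda},h)$.
   Context: A number $\beta\in(1,2)$ is a Garsia number if it is an algebraic integer with norm $\pm2$ whose Galois conjugates are all of modulus strictly greater than $1$. For $\lambda\in(1/2,1)$ let $S_\lambda=\{S_0,S_1\}$ be the iterated function system on $\mathbb{R}$ with $S_0(x)=\lambda x$, $S_1(x)=\lambda x+1$, and let $T_i=S_i^{-1}$; its invariant set is $[0,\frac1{1-\lambda}]$. For $h:\mathbb{N}\to[0,\infty)$, $R(S_\lambda,h)$ is the set of $x\in[0,\frac1{1-\lambda}]$ such that $$(T_{i_N}\circ\cdots\circ T_{i_1})(x)\in B\left(x,\frac{h(N)}{(2\lambda)^N}\right)$$ for infinitely many words $(i_1,\ldots,i_N)\in\bigcup_{n\ge1}\{0,1\}^n$, where $B(x,r)=[x-r,x+r]$. *)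

theory Defs
  imports
    "HOL-Analysis.Analysis"
    "HOL-Computational_Algebra.Computational_Algebra"
begin

definition min_poly_rat :: "'a :: field_char_0 \<Rightarrow> rat poly" where
  "min_poly_rat x =
     (THE p. lead_coeff p = 1 \<and> irreducible p \<and> poly (map_poly of_rat p) x = 0)"

text \<open>For algebraic arguments the definite description above picks out a polynomial.\<close>

lemma min_poly_rat_ex1:
  fixes x :: "'a :: field_char_0"
  assumes "algebraic x"
  shows "\<exists>!p :: rat poly. lead_coeff p = 1 \<and> irreducible p \<and> poly (map_poly of_rat p) x = 0"
proof -
  define E where "E = (\<lambda>p. poly (map_poly of_rat p) x)"
  have E_pCons: "E (pCons a p) = of_rat a + x * E p" for a p
    by (simp add: E_def map_poly_pCons)
  have E_0: "E 0 = 0"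
    by (simp add: E_def)
  have E_add: "E (p + q) = E p + E q" for p q
    by (induction p q rule: poly_induct2)
      (simp_all add: E_0 E_pCons of_rat_add algebra_simps)
  have E_smult: "E (smult c p) = of_rat c * E p" for c p
    by (induction p) (simp_all add: E_0 E_pCons of_rat_mult algebra_simps)
  have E_mult: "E (p * q) = E p * E q" for p q
    by (induction p)
      (simp_all add: E_0 E_pCons E_add E_smult algebra_simps)
  from assms obtain r where r: "\<And>i. coeff r i \<in> \<rat>" "r \<noteq> 0" "poly r x = 0"
    by (auto simp: algebraic_altdef)
  from r(1) obtain r' where "r = map_poly of_rat r'"
    using ratpolyE by blast
  then have "r' \<noteq> 0 \<and> E r' = 0"
    using r by (auto simp: E_def)
  then obtain m where m: "m \<noteq> 0" "E m = 0"
    and m_min: "\<And>q. q \<noteq> 0 \<Longrightarrow> E q = 0 \<Longrightarrow> degree m \<le> degree q"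
    using ex_has_least_nat[of "\<lambda>q. q \<noteq> 0 \<and> E q = 0" r' degree] by blast
  define p where "p = smult (inverse (lead_coeff m)) m"
  have p: "lead_coeff p = 1" "p \<noteq> 0" "E p = 0"
    using m by (simp_all add: p_def E_smult)
  have p_min: "degree p \<le> degree q" if "q \<noteq> 0" "E q = 0" for q
    using m_min[OF that] m(1) by (simp add: p_def)
  have unit: "b dvd 1" if "p = a * b" "E a = 0" for a b
  proof -
    from that p(2) have "a \<noteq> 0" "b \<noteq> 0"
      by auto
    with that p_min[of a] have "degree b = 0"
      by (simp add: degree_mult_eq)
    with \<open>b \<noteq> 0\<close> show ?thesis
      by (simp add: is_unit_iff_degree)
  qed
  have p_not_unit: "\<not> p dvd 1"
  proof
    assume "p dvd 1"
    then obtain q where "1 = p * q"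
      by blast
    then have "E 1 = 0"
      using p(3) E_mult[of p q] by (metis mult_zero_left)
    then show False
      by (simp add: E_def)
  qed
  have irr: "irreducible p"
  proof (rule irreducibleI)
    fix a b assume ab: "p = a * b"
    then have "E a = 0 \<or> E b = 0"
      using p(3) by (simp add: E_mult)
    then show "a dvd 1 \<or> b dvd 1"
      using unit[of a b] unit[of b a] ab by (auto simp: mult.commute)
  qed (use p p_not_unit in auto)
  have uniq: "q = p" if q: "lead_coeff q = 1" "irreducible q" "E q = 0" for q
  proof -
    have "E (q mod p) = 0"
      using E_add[of "q div p * p" "q mod p"] p(3) q(3) by (simp add: E_mult)
    then have "q mod p = 0"
      using p_min[of "q mod p"] degree_mod_less[of p q] p(2) by fastforce
    then obtain c where c: "q = p * c"
      by (metis mod_0_imp_dvd dvdE)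
    with q(2) p_not_unit have "c dvd 1"
      using irreducibleD by blast
    then obtain k where "c = [:k:]"
      by (auto elim: is_unit_polyE)
    with c have "q = smult k p"
      by simp
    moreover from this have "k = 1"
      using p(1) q(1) by (metis lead_coeff_smult mult.right_neutral)
    ultimately show ?thesis
      by simp
  qed
  show ?thesis
    using p(1,3) irr uniq unfolding E_def by blast
qed

text \<open>The Galois conjugates include the number itself. As minimal polynomials over the
  rationals are separable, the norm from the field generated by the number
  is the product over a set without multiplicities.\<close>

definition galois_conjugates :: "'a :: field_char_0 \<Rightarrow> complex set" where
  "galois_conjugates x = {z. poly (map_poly of_rat (min_poly_rat x)) z = 0}"

definition algebraic_norm :: "'a :: field_char_0 \<Rightarrow> complex" where
  "algebraic_norm x = (\<Prod>z\<in>galois_conjugates x. z)"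

definition garsia_number :: "real \<Rightarrow> bool" where
  "garsia_number \<beta> \<longleftrightarrow>
     1 < \<beta> \<and> \<beta> < 2 \<and> algebraic_int \<beta> \<and>
     (algebraic_norm \<beta> = 2 \<or> algebraic_norm \<beta> = -2) \<and>
     (\<forall>z\<in>galois_conjugates \<beta>. norm z > 1)"

definition ifs_map :: "real \<Rightarrow> nat \<Rightarrow> real \<Rightarrow> real" where
  "ifs_map l i x = (if i = 0 then l * x else l * x + 1)"

text \<open>For the word \<open>[i\<^sub>1, \<dots>, i\<^sub>N]\<close> the composition is \<open>T i\<^sub>N \<circ> \<dots> \<circ> T i\<^sub>1\<close>, so the head of the list
  acts first.\<close>

definition ifs_inverse_word :: "real \<Rightarrow> nat list \<Rightarrow> real \<Rightarrow> real" where
  "ifs_inverse_word l w = fold (\<lambda>i. inv (ifs_map l i)) w"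

definition recurrence_set :: "real \<Rightarrow> (nat \<Rightarrow> real) \<Rightarrow> real set" where
  "recurrence_set l h =
     {x \<in> {0..1 / (1 - l)}.
        infinite {w \<in> lists {0, 1}. w \<noteq> [] \<and>
          ifs_inverse_word l w x \<in> cball x (h (length w) / (2 * l) ^ length w)}}"

end

theory Submission
  imports Defs
    "Jordan_Normal_Form.Determinant"
    "Berlekamp_Zassenhaus.Factor_Bound"
begin

text \<open>
  Write \<open>\<beta> = 1 / l\<close> and \<open>s w = \<Sum>k. w ! k * l ^ k\<close> (\<^const>\<open>horner_sum\<close>). The inverse branch along a
  word \<open>w\<close> of length \<open>n\<close> is \<open>x \<mapsto> (x - s w) / l ^ n\<close>. It expands by \<open>\<beta> ^ n\<close> around its fixed point
  \<open>p w = s w / (1 - l ^ n)\<close>, so a point returns to within \<open>h n / (2 * l) ^ n\<close> of itself as soon as it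
  lies within \<open>h n / 2 ^ n\<close> of \<open>p w\<close>. Let \<open>E\<close> be the set of points that lie in infinitely many of the
  balls \<open>cball (p w) (g n / 2 ^ n)\<close>, where \<open>g\<close> is \<open>h\<close> cut off at a small constant; the series of \<open>g\<close>
  still diverges. It suffices that \<open>E\<close> has full measure in \<open>[0, 1 / (1 - l)]\<close>.

  Arithmetic enters through separation (\<open>garsia_separation\<close>). For words \<open>u \<noteq> v\<close> of length \<open>n\<close> the
  number \<open>\<beta> ^ (n - 1) * (s u - s v)\<close> is the value at \<open>\<beta>\<close> of a nonzero polynomial \<open>f\<close> with coefficients
  in \<open>{-1, 0, 1}\<close>. No conjugate of \<open>\<beta>\<close> is a root of \<open>f\<close>, because the minimal polynomial has constant
  term \<open>\<plusminus>2\<close> while the lowest nonzero coefficient of \<open>f\<close> is \<open>\<plusminus>1\<close>. Hence the norm of \<open>f \<beta>\<close> is a nonzero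
  integer. The other conjugates \<open>z\<close> contribute at most a constant times \<open>\<Prod>\<bar>z\<bar> ^ n = (2 / \<beta>) ^ n\<close>, so
  \<open>\<bar>s u - s v\<bar> \<ge> \<delta> / 2 ^ n\<close>: the \<open>2 ^ n\<close> points of generation \<open>n\<close> are, up to a
  constant, as separated as they can be.

  Separation bounds the number of points of generation \<open>n\<close> in a ball of generation \<open>m < n\<close>, which
  makes the generations quasi-independent, and a second moment argument gives a lower bound for the
  measure of their limsup (\<open>measure_Limsup_separated_balls\<close>). The bound is the number of points per
  \<open>2 ^ n\<close> times the separation constant. For the words with a fixed prefix \<open>w\<close> of length \<open>k\<close> the first
  factor is \<open>1 / 2 ^ k\<close> and, since \<open>s (w @ v) = s w + l ^ k * s v\<close>, the second improves to
  \<open>\<delta> * (2 * l) ^ k\<close>. So \<open>E\<close> fills at least the proportion \<open>\<delta> * (1 - l)\<close> of every cylinder interval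
  \<open>[s w, s w + l ^ k / (1 - l)]\<close> (\<open>Limsup_near_fixpoints_cylinder\<close>). The proportion depends neither on
  \<open>w\<close> nor on \<open>h\<close>. The cylinders form a Vitali cover of \<open>[0, 1 / (1 - l)]\<close>, and a set that
  fills a fixed proportion of arbitrarily small balls around every point has full measure
  (\<open>negligible_Diff_if_locally_large\<close>).
\<close>

hide_const (open) Coset.order module.smult up_ring.monom up_ring.coeff Divisibility.irreducible

section \<open>Integrality of the minimal polynomial and of norms\<close>

text \<open>
  Otherwise the two polynomials are coprime, and a Bezout identity evaluated at the common root
  reads \<open>0 = 1\<close>.
\<close>

lemma irreducible_dvd_if_common_root:
  fixes f g :: "rat poly" and x :: "'a :: field_char_0"
  assumes "irreducible f" and "poly (map_poly of_rat f) x = 0" and "poly (map_poly of_rat g) x = 0"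
  shows "f dvd g"
proof (rule ccontr)
  interpret P: map_poly_idom_hom "of_rat :: rat \<Rightarrow> 'a" ..
  assume "\<not> f dvd g"
  with \<open>irreducible f\<close> have "algebraic_semidom_class.coprime f g"
    by (intro prime_elem_imp_coprime field_poly_irreducible_imp_prime)
  then have "gcd f g = 1"
    by (rule coprime_imp_gcd_eq_1)
  then obtain a b where "a * f + b * g = 1"
    using bezout_coefficients_fst_snd[of f g] by metis
  then have "poly (map_poly of_rat (a * f + b * g)) x = (1 :: 'a)"
    by simp
  with assms(2,3) show False
    by (simp add: P.hom_add P.hom_mult)
qed

lemma min_poly_rat:
  fixes x :: "'a :: field_char_0"
  assumes "algebraic x"
  shows "lead_coeff (min_poly_rat x) = 1" "irreducible (min_poly_rat x)"
    "poly (map_poly of_rat (min_poly_rat x)) x = 0"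
  using theI'[OF min_poly_rat_ex1[OF assms]] unfolding min_poly_rat_def by auto

text \<open>
  Gauss's lemma: a factor over the rationals of a monic integer polynomial becomes, up to scaling,
  a factor over the integers, and comparing leading coefficients shows that the scaling is trivial.
\<close>

lemma min_poly_rat_integral:
  fixes x :: "'a :: field_char_0"
  assumes "algebraic_int x"
  obtains m :: "int poly" where "lead_coeff m = 1" "min_poly_rat x = of_int_poly m"
proof -
  let ?M = "min_poly_rat x"
  note M = min_poly_rat[OF algebraic_int_imp_algebraic[OF assms]]
  obtain q :: "int poly" where q: "poly (of_int_poly q) x = 0" "lead_coeff q = 1"
    using assms unfolding algebraic_int_altdef_ipoly by blast
  have "map_poly of_rat (of_int_poly q) = (of_int_poly q :: 'a poly)"
    by (simp add: map_poly_map_poly o_def)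
  with q(1) have "?M dvd of_int_poly q"
    by (intro irreducible_dvd_if_common_root[OF M(2,3)]) simp
  then obtain h where h: "of_int_poly q = ?M * h"
    by blast
  obtain d g where dg: "rat_to_normalized_int_poly ?M = (d, g)"
    by fastforce
  note g = rat_to_normalized_int_poly(1,2)[OF dg]
  obtain r where "q = g * r"
    using rat_to_int_factor_explicit[OF h dg] by blast
  with q(2) have "lead_coeff g * lead_coeff r = 1"
    by (simp add: lead_coeff_mult)
  then have "lead_coeff g = 1 \<or> lead_coeff g = -1"
    using zmult_eq_1_iff by blast
  moreover have "d * of_int (lead_coeff g) = 1"
    using M(1) g(2) arg_cong[OF g(1), of lead_coeff] by simp
  ultimately have "lead_coeff g = 1" "d = 1"
    using g(2) by auto
  with g(1) show thesis
    by (intro that[of g]) auto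
qed

lemma monic_int_division:
  fixes f m :: "int poly"
  assumes "lead_coeff m = 1"
  obtains q r where "f = m * q + r" "r = 0 \<or> degree r < degree m"
proof -
  obtain q r where qr: "pseudo_divmod f m = (q, r)"
    by fastforce
  have "m \<noteq> 0"
    using assms by auto
  from pseudo_divmod[OF this qr] assms show thesis
    by (intro that[of q r]) simp_all
qed

text \<open>
  The norm of an element of an order is an integer. On the basis \<open>1, x, \<dots>, x ^ (n - 1)\<close> of integer
  polynomials modulo \<open>m\<close>, multiplication by \<open>f\<close> is given by an integer matrix \<open>B\<close>. Evaluation at the
  roots, the Vandermonde matrix \<open>W\<close>, turns this multiplication into the diagonal matrix \<open>D\<close> of the
  values of \<open>f\<close>. So \<open>W * C = D * W\<close>, where \<open>C\<close> is \<open>B\<close> over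
  the complex numbers, and \<open>W\<close> has nonzero determinant since the roots are distinct.
\<close>

lemma prod_conjugate_values_int:
  fixes m f :: "int poly" and Z :: "complex set"
  assumes m: "lead_coeff m = 1" and Z: "finite Z" "card Z = degree m"
    and root: "\<And>z. z \<in> Z \<Longrightarrow> poly (of_int_poly m) z = 0"
  shows "(\<Prod>z\<in>Z. poly (of_int_poly f) z) \<in> \<int>"
proof -
  define n where "n = degree m"
  obtain z where z: "bij_betw z {0..<n} Z"
    using ex_bij_betw_nat_finite[OF Z(1)] unfolding n_def Z(2) by blast
  have "\<exists>r. (r = 0 \<or> degree r < n) \<and> (\<exists>q. f * monom 1 i = m * q + r)" for i
    by (rule monic_int_division[OF m, of "f * monom 1 i"]) (auto simp: n_def)
  then obtain r where r: "\<And>i. r i = 0 \<or> degree (r i) < n"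
    and "\<And>i. \<exists>q. f * monom 1 i = m * q + r i"
    by metis
  then obtain q where q: "\<And>i. f * monom 1 i = m * q i + r i"
    by metis
  have r_root: "poly (of_int_poly (r i)) z = poly (of_int_poly f) z * z ^ i" if "z \<in> Z" for i z
  proof -
    have "poly (of_int_poly (f * monom 1 i)) z = poly (of_int_poly (m * q i + r i)) z"
      by (simp only: q)
    with root[OF that] show ?thesis
      by (simp add: hom_distribs poly_monom of_int_hom.map_poly_hom_monom)
  qed
  define W where "W = Matrix.mat n n (\<lambda>(j, i). z j ^ i)"
  define B where "B = Matrix.mat n n (\<lambda>(k, i). coeff (r i) k)"
  define D where "D = Matrix.mat n n (\<lambda>(j, i). if i = j then poly (of_int_poly f) (z j) else 0)"
  define C :: "complex mat" where "C = map_mat of_int B"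
  have carrier: "W \<in> carrier_mat n n" "C \<in> carrier_mat n n" "D \<in> carrier_mat n n"
    by (simp_all add: W_def B_def C_def D_def)
  have zZ: "z j \<in> Z" if "j < n" for j
    using z that by (auto simp: bij_betw_def)
  have "W * C = D * W"
  proof (rule eq_matI)
    fix j i assume "j < dim_row (D * W)" "i < dim_col (D * W)"
    then have ji: "j < n" "i < n"
      using carrier by auto
    have "(W * C) $$ (j, i) = (\<Sum>k<n. z j ^ k * of_int (coeff (r i) k))"
      using ji by (simp add: W_def C_def B_def scalar_prod_def atLeast0LessThan)
    also have "\<dots> = poly (of_int_poly (r i)) (z j)"
    proof (cases "r i = 0")
      case False
      then have "degree (r i) < n" using r by blast
      then have "(\<Sum>k<n. z j ^ k * of_int (coeff (r i) k)) =
          (\<Sum>k\<le>degree (r i). z j ^ k * of_int (coeff (r i) k))"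
        by (intro sum.mono_neutral_right) (auto simp: coeff_eq_0)
      then show ?thesis
        by (simp add: poly_altdef mult.commute)
    qed simp
    also have "\<dots> = poly (of_int_poly f) (z j) * z j ^ i"
      using r_root zZ ji by simp
    also have "\<dots> = (D * W) $$ (j, i)"
      using ji by (simp add: W_def D_def scalar_prod_def if_distrib[of "\<lambda>x. x * _"] cong: if_cong)
    finally show "(W * C) $$ (j, i) = (D * W) $$ (j, i)" .
  qed (simp_all add: W_def C_def B_def D_def)
  then have "Determinant.det W * Determinant.det C = Determinant.det D * Determinant.det W"
    using det_mult[OF carrier(1,2)] det_mult[OF carrier(3,1)] by argo
  moreover have "Determinant.det W \<noteq> 0"
  proof
    assume "Determinant.det W = 0"
    \<comment> \<open>A kernel vector lists the coefficients of a nonzero polynomial of degree less than \<open>n\<close> that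
      vanishes on all of \<open>Z\<close>.\<close>
    then obtain v where v: "v \<in> carrier_vec n" "v \<noteq> 0\<^sub>v n" "W *\<^sub>v v = 0\<^sub>v n"
      using det_0_iff_vec_prod_zero_field[OF carrier(1)] by blast
    define p where "p = (\<Sum>k<n. monom (vec_index v k) k)"
    have coeff_p: "coeff p k = vec_index v k" if "k < n" for k
      using that by (simp add: p_def coeff_sum)
    have "p \<noteq> 0"
      using v coeff_p by (auto simp: vec_eq_iff)
    have n: "n > 0"
      using v by (cases n) auto
    have "degree p < n"
      unfolding p_def using n by (intro degree_sum_less) (auto intro: le_less_trans[OF degree_monom_le])
    moreover have "poly p w = 0" if "w \<in> Z" for w
    proof -
      obtain j where j: "j < n" "w = z j"
        using z \<open>w \<in> Z\<close> by (auto simp: bij_betw_def)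
      have "vec_index (W *\<^sub>v v) j = (\<Sum>k<n. z j ^ k * vec_index v k)"
        using j v(1) by (simp add: W_def scalar_prod_def atLeast0LessThan)
      with j v(3) show ?thesis
        by (simp add: p_def poly_sum poly_monom mult.commute)
    qed
    then have "card Z \<le> card {w. poly p w = 0}"
      by (intro card_mono poly_roots_finite \<open>p \<noteq> 0\<close>) auto
    then have "n \<le> degree p"
      using card_poly_roots_bound[OF \<open>p \<noteq> 0\<close>] Z by (simp add: n_def)
    ultimately show False
      by simp
  qed
  ultimately have "Determinant.det D = of_int (Determinant.det B)"
    by (simp add: C_def)
  moreover have "Determinant.det D = (\<Prod>j\<in>{0..<n}. poly (of_int_poly f) (z j))"
  proof (subst det_upper_triangular)
    show "upper_triangular D"
      by (auto simp: D_def)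
    show "prod_list (diag_mat D) = (\<Prod>j\<in>{0..<n}. poly (of_int_poly f) (z j))"
      unfolding prod_list_diag_prod by (simp add: D_def)
  qed (use carrier in auto)
  moreover have "(\<Prod>w\<in>Z. poly (of_int_poly f) w) = (\<Prod>j\<in>{0..<n}. poly (of_int_poly f) (z j))"
    using z by (rule prod.reindex_bij_betw[symmetric])
  ultimately show ?thesis
    by simp
qed

section \<open>Separation of finite expansions in a Garsia base\<close>

text \<open>
  The minimal polynomial is coprime to its derivative, so over the complex numbers it is the
  product of distinct linear factors; comparing degrees and constant terms gives the claims.
\<close>

lemma galois_conjugates_card_norm:
  fixes x :: "'a :: field_char_0"
  assumes "algebraic x"
  shows "finite (galois_conjugates x)" "card (galois_conjugates x) = degree (min_poly_rat x)"
    "algebraic_norm x = (- 1) ^ degree (min_poly_rat x) * of_rat (coeff (min_poly_rat x) 0)"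
proof -
  let ?M = "min_poly_rat x" and ?Z = "galois_conjugates x"
  define p where "p = (map_poly of_rat ?M :: complex poly)"
  note M = min_poly_rat[OF assms]
  have Z: "?Z = {z. poly p z = 0}"
    by (simp add: galois_conjugates_def p_def)
  have lc: "lead_coeff p = 1" and deg: "degree p = degree ?M"
    using M(1) by (simp_all add: p_def)
  have "p \<noteq> 0"
    using lc by auto
  then show fin: "finite ?Z"
    unfolding Z by (rule poly_roots_finite)
  have "0 < degree ?M"
    using M(2) by (auto simp: irreducible_def is_unit_iff_degree)
  have "rsquarefree p"
    unfolding rsquarefree_roots
  proof (intro allI notI)
    fix z assume z: "poly p z = 0 \<and> poly (pderiv p) z = 0"
    then have "?M dvd pderiv ?M"
      using M(2) by (intro irreducible_dvd_if_common_root[of _ z])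
        (simp_all add: p_def of_rat_hom.map_poly_pderiv)
    moreover have "pderiv ?M \<noteq> 0"
      using \<open>0 < degree ?M\<close> by (simp add: pderiv_eq_0_iff)
    ultimately have "degree ?M \<le> degree (pderiv ?M)"
      by (rule dvd_imp_degree_le)
    then show False
      using \<open>0 < degree ?M\<close> by (simp add: degree_pderiv)
  qed
  then have decomp: "(\<Prod>z\<in>?Z. [:-z, 1:]) = p"
    using complex_poly_decompose_rsquarefree[of p] lc Z by simp
  have "degree (\<Prod>z\<in>?Z. [:-z, 1:]) = card ?Z"
    by (subst degree_prod_eq_sum_degree) auto
  then show card: "card ?Z = degree ?M"
    using decomp deg by simp
  have "coeff p 0 = (\<Prod>z\<in>?Z. - z)"
    by (simp flip: decomp poly_0_coeff_0 add: poly_prod)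
  also have "\<dots> = (- 1) ^ card ?Z * (\<Prod>z\<in>?Z. z)"
    by (simp add: prod_uminus)
  finally have "(- 1) ^ card ?Z * coeff p 0 = ((- 1) ^ card ?Z * (- 1) ^ card ?Z) * algebraic_norm x"
    by (simp add: algebraic_norm_def)
  then show "algebraic_norm x = (- 1) ^ degree ?M * of_rat (coeff ?M 0)"
    by (simp add: card p_def flip: power_add)
qed

lemma poly_eq_sum_lessThan:
  fixes p :: "'a :: comm_semiring_1 poly"
  assumes "\<And>i. n \<le> i \<Longrightarrow> coeff p i = 0"
  shows "poly p x = (\<Sum>i<n. coeff p i * x ^ i)"
proof -
  have "(\<Sum>i\<le>degree p. coeff p i * x ^ i) = (\<Sum>i<n. coeff p i * x ^ i)"
  proof (rule sum.mono_neutral_cong)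
    fix i assume "i \<in> {..degree p} - {..<n}"
    then show "coeff p i * x ^ i = 0"
      using assms[of i] by simp
  next
    fix i assume "i \<in> {..<n} - {..degree p}"
    then show "coeff p i * x ^ i = 0"
      by (simp add: coeff_eq_0)
  qed auto
  then show ?thesis
    by (simp add: poly_altdef)
qed

text \<open>
  After removal of a power of the variable, \<open>f\<close> has an odd constant term, and it stays a multiple of
  \<open>m\<close> over the integers if it has a root in common with \<open>m\<close>. But then its constant term is a multiple
  of the even constant term of \<open>m\<close>.
\<close>

lemma small_poly_no_common_root:
  fixes m f :: "int poly" and z :: complex
  assumes m: "lead_coeff m = 1" "irreducible (of_int_poly m :: rat poly)" "even (coeff m 0)"
    and z: "poly (of_int_poly m) z = 0" "z \<noteq> 0"
    and f: "f \<noteq> 0" "\<And>i. \<bar>coeff f i\<bar> \<le> 1"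
  shows "poly (of_int_poly f) z \<noteq> 0"
proof
  assume root: "poly (of_int_poly f) z = 0"
  obtain q where q: "f = [:-0, 1:] ^ order 0 f * q" "\<not> [:-0, 1:] dvd q"
    using order_decomp[OF f(1)] by blast
  have fq: "f = monom 1 (order 0 f) * q"
    using q(1) by (simp add: monom_altdef)
  have q0: "coeff q 0 \<noteq> 0" "\<bar>coeff q 0\<bar> \<le> 1"
  proof -
    show "coeff q 0 \<noteq> 0"
      using q(2) poly_eq_0_iff_dvd[of q 0] by (simp add: poly_0_coeff_0)
    have "coeff f (order 0 f) = coeff q 0"
      by (subst fq) (simp add: coeff_monom_mult)
    then show "\<bar>coeff q 0\<bar> \<le> 1"
      using f(2)[of "order 0 f"] by simp
  qed
  have "poly (of_int_poly (monom 1 (order 0 f) * q)) z = 0"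
    using root fq by simp
  then have qz: "poly (of_int_poly q) z = 0"
    using z(2) by (simp add: hom_distribs poly_monom)
  obtain h r where hr: "q = m * h + r" "r = 0 \<or> degree r < degree m"
    using monic_int_division[OF m(1)] by blast
  have "poly (of_int_poly (m * h + r)) z = 0"
    using qz hr(1) by simp
  then have rz: "poly (of_int_poly r) z = 0"
    using z(1) by (simp add: hom_distribs)
  have "r = 0"
  proof (rule ccontr)
    assume "r \<noteq> 0"
    have *: "map_poly of_rat (of_int_poly g) = (of_int_poly g :: complex poly)" for g
      by (simp add: map_poly_map_poly o_def)
    have "(of_int_poly m :: rat poly) dvd of_int_poly r"
      using m(2) z(1) rz by (intro irreducible_dvd_if_common_root[of _ z]) (simp_all add: *)
    then have "degree m \<le> degree r"
      using dvd_imp_degree_le[of "of_int_poly m :: rat poly" "of_int_poly r"] \<open>r \<noteq> 0\<close> by simp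
    with hr(2) \<open>r \<noteq> 0\<close> show False
      by simp
  qed
  then have "coeff q 0 = coeff m 0 * coeff h 0"
    using hr(1) by (simp add: coeff_mult_0)
  with m(3) have "even (coeff q 0)"
    by simp
  with q0 show False
    by presburger
qed

lemma norm_small_poly_le:
  fixes f :: "int poly" and z :: complex
  assumes "1 < norm z" and f: "\<And>i. \<bar>coeff f i\<bar> \<le> 1" "\<And>i. n \<le> i \<Longrightarrow> coeff f i = 0"
  shows "norm (poly (of_int_poly f) z) \<le> norm z ^ n / (norm z - 1)"
proof -
  have "norm (poly (of_int_poly f) z) = norm (\<Sum>i<n. of_int (coeff f i) * z ^ i)"
    using poly_eq_sum_lessThan[of n "of_int_poly f" z] f(2) by simp
  also have "\<dots> \<le> (\<Sum>i<n. norm z ^ i)"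
  proof (rule sum_norm_le)
    fix i
    have "\<bar>of_int (coeff f i)\<bar> \<le> (1 :: real)"
      using f(1)[of i] by linarith
    then show "norm (of_int (coeff f i) * z ^ i) \<le> norm z ^ i"
      by (simp add: norm_mult norm_power mult_left_le_one_le)
  qed
  also have "\<dots> = (norm z ^ n - 1) / (norm z - 1)"
    using assms(1) by (intro geometric_sum) auto
  also have "\<dots> \<le> norm z ^ n / (norm z - 1)"
    using assms(1) by (intro divide_right_mono) auto
  finally show ?thesis .
qed

text \<open>
  The product of the values of \<open>f\<close> at all conjugates is a nonzero integer, hence of modulus at least
  1. The factors at the conjugates other than \<open>\<beta>\<close> are bounded from above by geometric sums, and the
  product of the moduli of these conjugates is \<open>2 / \<beta>\<close>.
\<close>

lemma garsia_small_poly_lower_bound: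
  assumes "garsia_number \<beta>"
  obtains \<delta> where "0 < \<delta>"
    "\<And>f n. f \<noteq> 0 \<Longrightarrow> (\<And>i. \<bar>coeff f i\<bar> \<le> 1) \<Longrightarrow> (\<And>i. n \<le> i \<Longrightarrow> coeff f i = 0) \<Longrightarrow>
      \<delta> * (\<beta> / 2) ^ n \<le> \<bar>poly (of_int_poly f) \<beta>\<bar>"
proof -
  have \<beta>: "1 < \<beta>" "algebraic_int \<beta>"
    and nrm: "algebraic_norm \<beta> = 2 \<or> algebraic_norm \<beta> = -2"
    and big: "\<And>z. z \<in> galois_conjugates \<beta> \<Longrightarrow> 1 < norm z"
    using assms by (auto simp: garsia_number_def)
  have alg: "algebraic \<beta>"
    using \<beta>(2) by blast
  define Z where "Z = galois_conjugates \<beta>"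
  obtain m :: "int poly" where m: "lead_coeff m = 1" "min_poly_rat \<beta> = of_int_poly m"
    using min_poly_rat_integral[OF \<beta>(2)] by blast
  have irr: "irreducible (of_int_poly m :: rat poly)"
    using min_poly_rat(2)[OF alg] m(2) by simp
  have *: "map_poly of_rat (of_int_poly g) = (of_int_poly g :: 'b :: field_char_0 poly)" for g
    by (simp add: map_poly_map_poly o_def)
  have Z: "z \<in> Z \<longleftrightarrow> poly (of_int_poly m) z = 0" for z
    by (simp add: Z_def galois_conjugates_def m(2) *)
  have fin: "finite Z" and card: "card Z = degree m"
    using galois_conjugates_card_norm[OF alg] by (simp_all add: Z_def m(2))
  have "complex_of_int ((- 1) ^ degree m * coeff m 0) = algebraic_norm \<beta>"
    using galois_conjugates_card_norm(3)[OF alg] by (simp add: m(2))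
  then have "complex_of_int ((- 1) ^ degree m * coeff m 0) = of_int 2 \<or>
      complex_of_int ((- 1) ^ degree m * coeff m 0) = of_int (- 2)"
    using nrm by simp
  then have "(- 1) ^ degree m * coeff m 0 = 2 \<or> (- 1) ^ degree m * coeff m 0 = -2"
    by (simp only: of_int_eq_iff)
  then have "even ((- 1) ^ degree m * coeff m 0)"
    by (metis even_minus even_numeral)
  then have even: "even (coeff m 0)"
    by simp
  have "poly (of_int_poly m) \<beta> = 0"
    using min_poly_rat(3)[OF alg] by (simp add: m(2) *)
  moreover have "poly (of_int_poly m) (complex_of_real \<beta>) = of_real (poly (of_int_poly m) \<beta>)"
    by (simp add: poly_altdef)
  ultimately have \<beta>Z: "complex_of_real \<beta> \<in> Z"
    by (simp add: Z)
  define Y where "Y = Z - {complex_of_real \<beta>}"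
  have Y: "finite Y" "\<And>z. z \<in> Y \<Longrightarrow> 1 < norm z"
    using fin big by (auto simp: Y_def Z_def)
  define \<delta> where "\<delta> = (\<Prod>z\<in>Y. norm z - 1)"
  have "0 < \<delta>"
    unfolding \<delta>_def using Y(2) by (intro prod_pos) auto
  have "norm (algebraic_norm \<beta>) = 2"
    using nrm by auto
  then have "\<beta> * (\<Prod>z\<in>Y. norm z) = 2"
    using prod.remove[OF fin \<beta>Z, of norm] \<beta>(1)
    by (simp add: algebraic_norm_def prod_norm Y_def flip: Z_def)
  then have prodY: "(\<Prod>z\<in>Y. norm z) = 2 / \<beta>"
    using \<beta>(1) by (simp add: field_simps)
  show thesis
  proof (rule that[OF \<open>0 < \<delta>\<close>])
    fix f :: "int poly" and n
    assume f: "f \<noteq> 0" "\<And>i. \<bar>coeff f i\<bar> \<le> 1" "\<And>i. n \<le> i \<Longrightarrow> coeff f i = 0"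
    let ?v = "\<lambda>z :: complex. poly (of_int_poly f) z"
    have "(\<Prod>z\<in>Z. ?v z) \<in> \<int>"
      by (rule prod_conjugate_values_int[OF m(1) fin card]) (simp add: Z)
    moreover have "(\<Prod>z\<in>Z. ?v z) \<noteq> 0"
    proof -
      have "?v z \<noteq> 0" if "z \<in> Z" for z
        using that Z big[of z]
        by (intro small_poly_no_common_root[OF m(1) irr even _ _ f(1,2)]) (auto simp: Z_def)
      then show ?thesis
        using fin by simp
    qed
    ultimately have "1 \<le> norm (\<Prod>z\<in>Z. ?v z)"
      by (auto elim!: Ints_cases)
    also have "\<dots> = norm (?v (of_real \<beta>)) * (\<Prod>z\<in>Y. norm (?v z))"
      using prod.remove[OF fin \<beta>Z, of "\<lambda>z. norm (?v z)"] by (simp add: prod_norm Y_def)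
    also have "\<dots> \<le> norm (?v (of_real \<beta>)) * (\<Prod>z\<in>Y. norm z ^ n / (norm z - 1))"
      using Y(2) f by (intro mult_left_mono prod_mono conjI norm_small_poly_le) auto
    also have "(\<Prod>z\<in>Y. norm z ^ n / (norm z - 1)) = (2 / \<beta>) ^ n / \<delta>"
      by (simp add: prod_dividef prodY \<delta>_def flip: prod_power_distrib)
    also have "?v (of_real \<beta>) = of_real (poly (of_int_poly f) \<beta>)"
      by (simp add: poly_altdef)
    finally show "\<delta> * (\<beta> / 2) ^ n \<le> \<bar>poly (of_int_poly f) \<beta>\<bar>"
      using \<open>0 < \<delta>\<close> \<beta>(1) by (simp add: field_simps)
  qed
qed

text \<open>
  Multiplied by \<open>\<beta> ^ (n - 1)\<close>, the difference of the two sums becomes a polynomial value at \<open>\<beta>\<close> of the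
  kind treated above; the coefficients appear in reverse order.
\<close>

lemma garsia_separation:
  assumes "garsia_number (inverse l)" "0 < l"
  obtains \<delta> where "0 < \<delta>"
    "\<And>u v. u \<in> lists {0, 1} \<Longrightarrow> v \<in> lists {0, 1} \<Longrightarrow> length u = length v \<Longrightarrow> u \<noteq> v \<Longrightarrow>
      \<delta> / 2 ^ length u \<le> \<bar>horner_sum real l u - horner_sum real l v\<bar>"
proof -
  define \<beta> where "\<beta> = inverse l"
  have \<beta>: "1 < \<beta>" and l: "l = 1 / \<beta>"
    using assms by (auto simp: \<beta>_def garsia_number_def field_simps)
  obtain \<delta> where \<delta>: "0 < \<delta>"
    "\<And>f n. f \<noteq> 0 \<Longrightarrow> (\<And>i. \<bar>coeff f i\<bar> \<le> 1) \<Longrightarrow> (\<And>i. n \<le> i \<Longrightarrow> coeff f i = 0) \<Longrightarrow>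
      \<delta> * (\<beta> / 2) ^ n \<le> \<bar>poly (of_int_poly f) \<beta>\<bar>"
    using garsia_small_poly_lower_bound assms(1) unfolding \<beta>_def by metis
  show thesis
  proof (rule that[OF \<delta>(1)])
    fix u v :: "nat list"
    assume u: "u \<in> lists {0, 1}" and v: "v \<in> lists {0, 1}" and "length u = length v" "u \<noteq> v"
    define n where "n = length u"
    have len: "length u = n" "length v = n"
      using \<open>length u = length v\<close> by (simp_all add: n_def)
    define c where "c k = int (u ! k) - int (v ! k)" for k
    define f where "f = Poly (map (\<lambda>i. c (n - Suc i)) [0..<n])"
    have coeff_f: "coeff f i = (if i < n then c (n - Suc i) else 0)" for i
      by (simp add: f_def nth_default_def)
    have c: "\<bar>c k\<bar> \<le> 1" if "k < n" for k
    proof -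
      have "u ! k \<in> {0, 1}" "v ! k \<in> {0, 1}"
        using that u v len by (auto simp: in_lists_conv_set)
      then show ?thesis
        by (auto simp: c_def)
    qed
    obtain k where k: "k < n" "u ! k \<noteq> v ! k"
      using \<open>u \<noteq> v\<close> len nth_equalityI by metis
    then have "coeff f (n - Suc k) \<noteq> 0"
      by (simp add: coeff_f c_def)
    then have "f \<noteq> 0"
      by auto
    then have "\<delta> * (\<beta> / 2) ^ n \<le> \<bar>poly (of_int_poly f) \<beta>\<bar>"
      by (rule \<delta>(2)) (simp_all add: coeff_f c)
    \<comment> \<open>The extra factor \<open>\<beta>\<close> avoids the exponent \<open>n - 1\<close>.\<close>
    moreover have "\<beta> * poly (of_int_poly f) \<beta> = \<beta> ^ n * (horner_sum real l u - horner_sum real l v)"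
    proof -
      have "\<beta> * poly (of_int_poly f) \<beta> = (\<Sum>i<n. \<beta> * (of_int (c (n - Suc i)) * \<beta> ^ i))"
        using poly_eq_sum_lessThan[of n "of_int_poly f" \<beta>]
        by (simp add: coeff_f sum_distrib_left)
      also have "\<dots> = (\<Sum>i<n. \<beta> ^ n * (of_int (c (n - Suc i)) * l ^ (n - Suc i)))"
      proof (rule sum.cong)
        fix i assume "i \<in> {..<n}"
        then have "n = Suc i + (n - Suc i)"
          by simp
        then have "\<beta> ^ n = \<beta> * \<beta> ^ i * \<beta> ^ (n - Suc i)"
          by (metis power_Suc power_add)
        then show "\<beta> * (of_int (c (n - Suc i)) * \<beta> ^ i) =
            \<beta> ^ n * (of_int (c (n - Suc i)) * l ^ (n - Suc i))"
          using \<beta> by (simp add: l power_one_over field_simps)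
      qed simp
      also have "\<dots> = \<beta> ^ n * (\<Sum>i<n. of_int (c i) * l ^ i)"
        using sum.nat_diff_reindex[of "\<lambda>i. of_int (c i) * l ^ i" n] by (simp flip: sum_distrib_left)
      also have "(\<Sum>i<n. of_int (c i) * l ^ i) = horner_sum real l u - horner_sum real l v"
        by (simp add: horner_sum_eq_sum len c_def algebra_simps atLeast0LessThan sum_subtractf)
      finally show ?thesis .
    qed
    moreover have "\<bar>poly (of_int_poly f) \<beta>\<bar> \<le> \<bar>\<beta> * poly (of_int_poly f) \<beta>\<bar>"
      using \<beta> by (simp add: abs_mult mult_le_cancel_right1)
    ultimately have "\<delta> * (\<beta> / 2) ^ n \<le> \<beta> ^ n * \<bar>horner_sum real l u - horner_sum real l v\<bar>"
      using \<beta> by (simp add: abs_mult)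
    then show "\<delta> / 2 ^ length u \<le> \<bar>horner_sum real l u - horner_sum real l v\<bar>"
      using \<beta> by (simp add: len power_divide field_simps)
  qed
qed

section \<open>Limsup sets of separated balls\<close>

text \<open>
  The Chung--Erdos inequality: Cauchy--Schwarz for the counting function \<open>\<Sum>i\<in>A. indicator (E i)\<close>,
  which is supported on the union. It is proved by expanding the square of this function minus \<open>t\<close>
  times the indicator of the union and choosing the best \<open>t\<close>.
\<close>

lemma second_moment_bound:
  assumes "finite A" and E: "\<And>i. i \<in> A \<Longrightarrow> E i \<in> fmeasurable M"
  shows "(\<Sum>i\<in>A. measure M (E i))\<^sup>2 \<le>
    measure M (\<Union>i\<in>A. E i) * (\<Sum>i\<in>A. \<Sum>j\<in>A. measure M (E i \<inter> E j))"
proof -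
  define U where "U = (\<Union>i\<in>A. E i)"
  define a where "a = (\<Sum>i\<in>A. measure M (E i))"
  define b where "b = (\<Sum>i\<in>A. \<Sum>j\<in>A. measure M (E i \<inter> E j))"
  let ?u = "measure M U"
  have U: "U \<in> fmeasurable M"
    unfolding U_def using assms by (intro fmeasurable.finite_UN) auto
  have EE: "E i \<inter> E j \<in> fmeasurable M" if "i \<in> A" "j \<in> A" for i j
    using that E by auto
  have int: "integrable M (indicat_real X)" if "X \<in> fmeasurable M" for X
    using that by (simp add: fmeasurable_def)
  have lint: "integral\<^sup>L M (indicat_real X) = measure M X" if "X \<in> fmeasurable M" for X
    using that by (simp add: fmeasurable_def)
  have quad: "0 \<le> b - 2 * t * a + t\<^sup>2 * ?u" for t
  proof -
    let ?F = "\<lambda>x. (\<Sum>i\<in>A. indicat_real (E i) x) - t * indicat_real U x"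
    have F: "(?F x)\<^sup>2 = (\<Sum>i\<in>A. \<Sum>j\<in>A. indicat_real (E i \<inter> E j) x) -
        2 * t * (\<Sum>i\<in>A. indicat_real (E i) x) + t\<^sup>2 * indicat_real U x" for x
    proof (cases "x \<in> U")
      case True
      then show ?thesis
        by (simp add: power2_diff power2_eq_square sum_product indicator_inter_arith algebra_simps)
    next
      case False
      then have "indicat_real (E i) x = 0" if "i \<in> A" for i
        using that by (auto simp: U_def)
      with False show ?thesis
        by (simp add: indicator_inter_arith)
    qed
    have "0 \<le> (\<integral>x. (?F x)\<^sup>2 \<partial>M)"
      by simp
    also have "\<dots> = b - 2 * t * a + t\<^sup>2 * ?u"
      unfolding F a_def b_def using E EE U int lint by (simp add: Bochner_Integration.integral_sum)
    finally show ?thesis .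
  qed
  show ?thesis
  proof (cases "?u = 0")
    case True
    have "measure M (E i) = 0" if "i \<in> A" for i
    proof -
      have "measure M (E i) \<le> ?u"
        using that E U by (intro measure_mono_fmeasurable) (auto simp: U_def)
      with True show ?thesis
        using measure_nonneg[of M "E i"] by linarith
    qed
    then have "(\<Sum>i\<in>A. measure M (E i)) = 0"
      by simp
    then show ?thesis
      by (simp add: sum_nonneg)
  next
    case False
    then have u: "?u > 0"
      using measure_nonneg[of M U] by linarith
    have "0 \<le> b - a\<^sup>2 / ?u"
      using quad[of "a / ?u"] u by (simp add: power2_eq_square field_simps)
    with u show ?thesis
      unfolding a_def[symmetric] b_def[symmetric] U_def[symmetric] by (simp add: field_simps)
  qed
qed

text \<open>
  Half-open cells of length \<open>\<sigma>\<close> contain at most one point each.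
\<close>

lemma card_separated_le:
  fixes S :: "real set"
  assumes "S \<subseteq> {a..b}" "a \<le> b" "0 < \<sigma>"
    and sep: "\<And>x y. x \<in> S \<Longrightarrow> y \<in> S \<Longrightarrow> x \<noteq> y \<Longrightarrow> \<sigma> \<le> \<bar>x - y\<bar>"
  shows "real (card S) \<le> 1 + (b - a) / \<sigma>"
proof -
  define f where "f x = nat \<lfloor>(x - a) / \<sigma>\<rfloor>" for x
  have "inj_on f S"
  proof (rule inj_onI)
    fix x y assume xy: "x \<in> S" "y \<in> S" "f x = f y"
    then have "0 \<le> (x - a) / \<sigma>" "0 \<le> (y - a) / \<sigma>"
      using assms by auto
    with xy(3) have "\<lfloor>(x - a) / \<sigma>\<rfloor> = \<lfloor>(y - a) / \<sigma>\<rfloor>"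
      unfolding f_def by (metis eq_nat_nat_iff zero_le_floor)
    then have "\<bar>(x - a) / \<sigma> - (y - a) / \<sigma>\<bar> < 1"
      by linarith
    then have "\<bar>x - y\<bar> < \<sigma>"
      using \<open>0 < \<sigma>\<close> by (simp add: field_simps abs_if split: if_splits)
    with sep xy show "x = y"
      by force
  qed
  moreover have "f ` S \<subseteq> {..nat \<lfloor>(b - a) / \<sigma>\<rfloor>}"
    using assms(1,3) by (auto simp: f_def intro!: nat_mono floor_mono divide_right_mono)
  ultimately have "card S \<le> card {..nat \<lfloor>(b - a) / \<sigma>\<rfloor>}"
    by (intro card_inj_on_le[of f]) auto
  then have "real (card S) \<le> 1 + real (nat \<lfloor>(b - a) / \<sigma>\<rfloor>)"
    by simp
  also have "real (nat \<lfloor>(b - a) / \<sigma>\<rfloor>) \<le> (b - a) / \<sigma>"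
    using assms(2,3) by (simp add: divide_nonneg_pos)
  finally show ?thesis by simp
qed

lemma sum_inverse_powers_le: "(\<Sum>m\<in>{k..n}. 1 / 2 ^ (n - m)) \<le> (2 :: real)"
proof -
  have "(\<Sum>m\<in>{k..n}. 1 / 2 ^ (n - m)) \<le> (\<Sum>m\<in>{..n}. 1 / 2 ^ (n - m) :: real)"
    by (intro sum_mono2) auto
  also have "\<dots> = (\<Sum>j\<le>n. (1 / 2) ^ j)"
    by (rule sum.reindex_bij_witness[of _ "\<lambda>j. n - j" "\<lambda>j. n - j"]) (auto simp: power_one_over)
  also have "\<dots> = 2 - (1 / 2) ^ n"
    by (induction n) auto
  finally show ?thesis
    using zero_le_power[of "1 / 2 :: real" n] by linarith
qed

text \<open>
  Let \<open>E n\<close> be the union of the balls of generation \<open>n\<close>. The balls of one generation are disjoint, so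
  \<open>E n\<close> has measure \<open>2 * K * g n\<close>. For \<open>m < n\<close> a ball of radius \<open>g m / 2 ^ m\<close> meets at most
  \<open>2 + 2 * g m * 2 ^ (n - m) / s\<close> balls of generation \<open>n\<close> by separation. Therefore the measure of
  \<open>E m \<inter> E n\<close> is at most a constant times \<open>g m * g n\<close> plus a term that decays like \<open>2 ^ (m - n)\<close> and
  adds up to a multiple of the sum \<open>G\<close> of \<open>g\<close>. With \<open>G\<close> large, the terms linear in \<open>G\<close> are
  negligible, and the second moment bound tends to \<open>(2 * K * G)\<^sup>2 / (4 * K / s * G\<^sup>2) = K * s\<close>. The
  bound holds for every tail of the sequence, hence for the limsup.
\<close>

lemma measure_Limsup_separated_balls:
  fixes P :: "nat \<Rightarrow> real set" and g :: "nat \<Rightarrow> real" and K s a b :: real and k :: nat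
  assumes card: "\<And>n. k \<le> n \<Longrightarrow> real (card (P n)) = K * 2 ^ n"
    and fin: "\<And>n. k \<le> n \<Longrightarrow> finite (P n)"
    and sep: "\<And>n p q. k \<le> n \<Longrightarrow> p \<in> P n \<Longrightarrow> q \<in> P n \<Longrightarrow> p \<noteq> q \<Longrightarrow> s / 2 ^ n \<le> \<bar>p - q\<bar>"
    and bdd: "\<And>n. k \<le> n \<Longrightarrow> P n \<subseteq> {a..b}"
    and "0 < s" and g: "\<And>n. 0 \<le> g n" "\<And>n. g n \<le> s / 3" and div: "\<not> summable g"
  shows "K * s \<le> measure lborel {x. \<exists>\<^sub>\<infinity>n. x \<in> (\<Union>p\<in>P n. cball p (g n / 2 ^ n))}"
proof -
  define r where "r n = g n / 2 ^ n" for n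
  define E where "E n = (\<Union>p\<in>P n. cball p (r n))" for n
  have r: "0 \<le> r n" "r n \<le> s" for n
  proof -
    show "0 \<le> r n" using g by (simp add: r_def)
    have "r n \<le> g n"
      using g(1)[of n] by (simp add: r_def divide_le_eq mult_le_cancel_left1)
    then show "r n \<le> s"
      using g(2)[of n] \<open>0 < s\<close> by linarith
  qed
  have K: "0 \<le> K"
    using card[of k] by (metis le_refl of_nat_0_le_iff zero_le_mult_iff zero_less_numeral zero_less_power not_le)
  have ball: "measure lborel (cball p (r n)) = 2 * r n" for p :: real and n
    using r(1)[of n] by (simp add: cball_eq_atLeastAtMost)
  have ball_fm: "cball p (r n) \<in> fmeasurable lborel" for p :: real and n
    by (simp add: fmeasurable_compact)
  have E_fm: "E n \<in> fmeasurable lborel" if "k \<le> n" for n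
    unfolding E_def using fin[OF that] ball_fm by (intro fmeasurable.finite_UN) auto
  have E_bdd: "E n \<subseteq> {a - s..b + s}" if "k \<le> n" for n
  proof
    fix x assume "x \<in> E n"
    then obtain p where "p \<in> P n" "\<bar>p - x\<bar> \<le> r n"
      by (auto simp: E_def dist_real_def)
    with bdd[OF that] r[of n] show "x \<in> {a - s..b + s}"
      by fastforce
  qed
  have E_measure: "measure lborel (E n) = 2 * K * g n" if n: "k \<le> n" for n
  proof -
    have "cball p (r n) \<inter> cball q (r n) = {}" if "p \<in> P n" "q \<in> P n" "p \<noteq> q" for p q
    proof (rule ccontr)
      assume "cball p (r n) \<inter> cball q (r n) \<noteq> {}"
      then obtain x where "\<bar>p - x\<bar> \<le> r n" "\<bar>q - x\<bar> \<le> r n"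
        by (auto simp: dist_real_def)
      then have "s / 2 ^ n \<le> 2 * r n"
        using sep[OF n that] by linarith
      then have "s \<le> 2 * g n"
        by (simp add: r_def field_simps)
      with g(2)[of n] \<open>0 < s\<close> show False by simp
    qed
    then have "measure lborel (E n) = (\<Sum>p\<in>P n. measure lborel (cball p (r n)))"
      unfolding E_def using fin[OF n] ball_fm[THEN fmeasurableD2]
      by (intro measure_finite_Union) (auto simp: disjoint_family_on_def)
    also have "\<dots> = K * 2 ^ n * (2 * r n)"
      unfolding ball by (simp add: card[OF n])
    finally show ?thesis
      by (simp add: r_def)
  qed
  have less_pair: "measure lborel (E m \<inter> E n) \<le> 4 * K * (g n / 2 ^ (n - m)) + 4 * K / s * (g m * g n)"
    if mn: "k \<le> m" "m < n" for m n
  proof -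
    have n: "k \<le> n" using mn by simp
    have two: "(2 :: real) ^ n = 2 ^ m * 2 ^ (n - m)"
      using mn by (simp flip: power_add)
    have gn: "r n * 2 ^ n = g n" and gm: "r m * 2 ^ n = g m * 2 ^ (n - m)"
      unfolding two by (simp_all add: r_def two)
    define Q where "Q p = {q \<in> P n. \<bar>p - q\<bar> \<le> r m + r n}" for p
    have Q: "real (card (Q p)) \<le> 2 + 2 * g m * 2 ^ (n - m) / s" for p
    proof -
      have "real (card (Q p)) \<le> 1 + (p + (r m + r n) - (p - (r m + r n))) / (s / 2 ^ n)"
        using \<open>0 < s\<close> r[of m] r[of n]
        by (intro card_separated_le) (auto simp: Q_def intro: sep[OF n])
      also have "p + (r m + r n) - (p - (r m + r n)) = 2 * (r m + r n)"
        by simp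
      also have "2 * (r m + r n) / (s / 2 ^ n) = 2 * (r m * 2 ^ n + r n * 2 ^ n) / s"
        by (simp only: divide_divide_eq_right mult.assoc distrib_right)
      also have "1 + 2 * (r m * 2 ^ n + r n * 2 ^ n) / s = 1 + 2 * g n / s + 2 * g m * 2 ^ (n - m) / s"
        unfolding gn gm by (simp add: add_divide_distrib distrib_left)
      finally have "real (card (Q p)) \<le> 1 + 2 * g n / s + 2 * g m * 2 ^ (n - m) / s" .
      moreover have "2 * g n / s \<le> 1"
        using g(2)[of n] \<open>0 < s\<close> by (simp add: divide_le_eq)
      ultimately show ?thesis
        by linarith
    qed
    have Q_fm: "(\<Union>q\<in>Q p. cball q (r n)) \<in> fmeasurable lborel" for p
      using fin[OF n] ball_fm by (intro fmeasurable.finite_UN) (auto simp: Q_def)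
    have "E m \<inter> E n \<subseteq> (\<Union>p\<in>P m. \<Union>q\<in>Q p. cball q (r n))"
    proof
      fix x assume "x \<in> E m \<inter> E n"
      then obtain p q where "p \<in> P m" "q \<in> P n" "\<bar>p - x\<bar> \<le> r m" "\<bar>q - x\<bar> \<le> r n"
        by (auto simp: E_def dist_real_def)
      then have "p \<in> P m" "q \<in> Q p" "x \<in> cball q (r n)"
        by (auto simp: Q_def dist_real_def)
      then show "x \<in> (\<Union>p\<in>P m. \<Union>q\<in>Q p. cball q (r n))"
        by blast
    qed
    then have "measure lborel (E m \<inter> E n) \<le> measure lborel (\<Union>p\<in>P m. \<Union>q\<in>Q p. cball q (r n))"
      using E_fm[OF mn(1)] E_fm[OF n] fin[OF mn(1)] Q_fm
      by (intro measure_mono_fmeasurable fmeasurable.finite_UN[of "P m"]) (auto simp: fmeasurable_def)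
    also have "\<dots> \<le> (\<Sum>p\<in>P m. measure lborel (\<Union>q\<in>Q p. cball q (r n)))"
      using fin[OF mn(1)] Q_fm by (intro measure_UNION_le) (auto simp: fmeasurable_def)
    also have "\<dots> \<le> (\<Sum>p\<in>P m. (2 + 2 * g m * 2 ^ (n - m) / s) * (2 * r n))"
    proof (rule sum_mono)
      fix p
      have "measure lborel (\<Union>q\<in>Q p. cball q (r n)) \<le> (\<Sum>q\<in>Q p. measure lborel (cball q (r n)))"
        using fin[OF n] by (intro measure_UNION_le) (auto simp: Q_def)
      also have "\<dots> = real (card (Q p)) * (2 * r n)"
        unfolding ball by simp
      also have "\<dots> \<le> (2 + 2 * g m * 2 ^ (n - m) / s) * (2 * r n)"
        using Q r[of n] by (intro mult_right_mono) auto
      finally show "measure lborel (\<Union>q\<in>Q p. cball q (r n)) \<le>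
          (2 + 2 * g m * 2 ^ (n - m) / s) * (2 * r n)" .
    qed
    also have "\<dots> = K * 2 ^ m * ((2 + 2 * g m * 2 ^ (n - m) / s) * (2 * r n))"
      by (simp add: card[OF mn(1)])
    also have "\<dots> = 4 * K * (g n / 2 ^ (n - m)) + 4 * K / s * (g m * g n)"
    proof -
      have "(r n * 2 ^ m) * 2 ^ (n - m) = g n"
        by (simp only: mult.assoc two[symmetric] gn)
      then have rn: "r n * 2 ^ m = g n / 2 ^ (n - m)"
        by (simp add: eq_divide_eq)
      have "K * 2 ^ m * ((2 + 2 * g m * 2 ^ (n - m) / s) * (2 * r n)) =
          4 * K * (r n * 2 ^ m) + 4 * K / s * (g m * ((r n * 2 ^ m) * 2 ^ (n - m)))"
        by (simp add: distrib_left distrib_right mult_ac)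
      then show ?thesis
        unfolding rn by simp
    qed
    finally show ?thesis .
  qed
  have pair: "measure lborel (E m \<inter> E n) \<le>
      4 * K * ((if m \<le> n then g n / 2 ^ (n - m) else 0) + (if n \<le> m then g m / 2 ^ (m - n) else 0)) +
      4 * K / s * (g m * g n)"
    if mn: "k \<le> m" "k \<le> n" for m n
  proof (cases m n rule: linorder_cases)
    case less
    then show ?thesis using less_pair[OF mn(1) less] by simp
  next
    case equal
    have "0 \<le> 6 * K * g n + 4 * K / s * (g n * g n)"
      using K g(1) \<open>0 < s\<close> by simp
    then show ?thesis
      using E_measure[OF mn(2)] equal by (simp add: algebra_simps)
  next
    case greater
    then show ?thesis using less_pair[OF mn(2) greater] by (simp add: Int_commute mult.commute)
  qed
  have lower: "K * s * sum g {l..<N} \<le> measure lborel (\<Union>n\<in>{l..<N}. E n) * (4 * s + sum g {l..<N})"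
    if l: "k \<le> l" for l N
  proof -
    let ?A = "{l..<N}" and ?U = "\<Union>n\<in>{l..<N}. E n"
    let ?G = "sum g ?A" and ?u = "measure lborel ?U"
    have G: "0 \<le> ?G"
      using g(1) by (simp add: sum_nonneg)
    have half: "(\<Sum>m\<in>?A. \<Sum>n\<in>?A. if m \<le> n then g n / 2 ^ (n - m) else 0) \<le> 2 * ?G"
    proof -
      have "(\<Sum>m\<in>?A. if m \<le> n then g n / 2 ^ (n - m) else 0) \<le> 2 * g n" if "n \<in> ?A" for n
      proof -
        have "(\<Sum>m\<in>?A. if m \<le> n then g n / 2 ^ (n - m) else 0) = (\<Sum>m\<in>{l..n}. g n / 2 ^ (n - m))"
          using that by (intro sum.mono_neutral_cong_right) auto
        also have "\<dots> = g n * (\<Sum>m\<in>{l..n}. 1 / 2 ^ (n - m))"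
          by (simp add: sum_distrib_left)
        also have "\<dots> \<le> g n * 2"
          by (intro mult_left_mono sum_inverse_powers_le g)
        finally show ?thesis by simp
      qed
      then show ?thesis
        unfolding sum_distrib_left by (subst sum.swap) (intro sum_mono, blast)
    qed
    have "(2 * K * ?G)\<^sup>2 = (\<Sum>n\<in>?A. measure lborel (E n))\<^sup>2"
      using l E_measure by (simp add: sum_distrib_left)
    also have "\<dots> \<le> ?u * (\<Sum>m\<in>?A. \<Sum>n\<in>?A. measure lborel (E m \<inter> E n))"
      using l E_fm by (intro second_moment_bound) auto
    also have "\<dots> \<le> ?u * (\<Sum>m\<in>?A. \<Sum>n\<in>?A. 4 * K * ((if m \<le> n then g n / 2 ^ (n - m) else 0) +
        (if n \<le> m then g m / 2 ^ (m - n) else 0)) + 4 * K / s * (g m * g n))"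
      using l by (intro mult_left_mono sum_mono pair) auto
    also have "\<dots> = ?u * (4 * K * ((\<Sum>m\<in>?A. \<Sum>n\<in>?A. if m \<le> n then g n / 2 ^ (n - m) else 0) +
        (\<Sum>m\<in>?A. \<Sum>n\<in>?A. if n \<le> m then g m / 2 ^ (m - n) else 0)) + 4 * K / s * (?G * ?G))"
      by (simp only: sum.distrib sum_distrib_left[symmetric] sum_product)
    also have "(\<Sum>m\<in>?A. \<Sum>n\<in>?A. if n \<le> m then g m / 2 ^ (m - n) else 0) =
        (\<Sum>m\<in>?A. \<Sum>n\<in>?A. if m \<le> n then g n / 2 ^ (n - m) else 0)"
      by (rule sum.swap)
    also have "?u * (4 * K * ((\<Sum>m\<in>?A. \<Sum>n\<in>?A. if m \<le> n then g n / 2 ^ (n - m) else 0) +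
        (\<Sum>m\<in>?A. \<Sum>n\<in>?A. if m \<le> n then g n / 2 ^ (n - m) else 0)) + 4 * K / s * (?G * ?G)) \<le>
        ?u * (4 * K * (2 * ?G + 2 * ?G) + 4 * K / s * (?G * ?G))"
      using half K by (intro mult_left_mono add_mono order_refl) auto
    also have "\<dots> = 4 * K * ?G / s * (?u * (4 * s + ?G))"
      using \<open>0 < s\<close> by (simp add: field_simps)
    finally have main: "4 * K * ?G / s * (K * s * ?G) \<le> 4 * K * ?G / s * (?u * (4 * s + ?G))"
      using \<open>0 < s\<close> by (simp add: power2_eq_square mult_ac)
    moreover have "0 \<le> ?u * (4 * s + ?G)"
      using G \<open>0 < s\<close> by simp
    ultimately show ?thesis
    proof (cases "K = 0 \<or> ?G = 0")
      case False
      with K G \<open>0 < s\<close> have "0 < 4 * K * ?G / s"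
        by simp
      with main show ?thesis
        by (rule mult_left_le_imp_le)
    qed auto
  qed
  define V where "V i = (\<Union>n\<in>{k + i..}. E n)" for i
  have V_fm: "V i \<in> fmeasurable lborel" for i
  proof (rule fmeasurableI2[of "{a - s..b + s}"])
    show "V i \<subseteq> {a - s..b + s}"
      unfolding V_def using E_bdd by (meson UN_least atLeast_iff le_add1 order_trans)
    show "V i \<in> sets lborel"
      using E_fm by (auto simp: V_def fmeasurable_def)
  qed (simp add: fmeasurable_compact)
  have V: "K * s \<le> measure lborel (V i)" for i
  proof (rule ccontr)
    let ?M = "measure lborel (V i)"
    assume "\<not> K * s \<le> ?M"
    then have M: "0 < K * s - ?M" by simp
    have "\<not> summable (\<lambda>n. g (n + (k + i)))"
      using div summable_iff_shift by blast
    then obtain N where N: "4 * s * ?M / (K * s - ?M) < (\<Sum>n<N. g (n + (k + i)))"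
      using summableI_nonneg_bounded[of "\<lambda>n. g (n + (k + i))"] g(1) by (meson not_le)
    define G where "G = sum g {k + i..<k + i + N}"
    have "(\<Sum>n<N. g (n + (k + i))) = G"
      unfolding G_def using sum.shift_bounds_nat_ivl[of g 0 "k + i" N]
      by (simp add: atLeast0LessThan add.commute)
    with N M have "4 * s * ?M < (K * s - ?M) * G"
      by (simp add: field_simps)
    moreover have "K * s * G \<le> ?M * (4 * s + G)"
    proof -
      have "measure lborel (\<Union>n\<in>{k + i..<k + i + N}. E n) \<le> ?M"
      proof (rule measure_mono_fmeasurable)
        show "(\<Union>n\<in>{k + i..<k + i + N}. E n) \<subseteq> V i"
          by (auto simp: V_def)
        show "(\<Union>n\<in>{k + i..<k + i + N}. E n) \<in> sets lborel"
          using E_fm by (intro sets.finite_UN) (auto simp: fmeasurable_def)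
      qed (rule V_fm)
      moreover have "0 \<le> 4 * s + G"
        using g(1) \<open>0 < s\<close> by (simp add: G_def sum_nonneg)
      ultimately show ?thesis
        using lower[of "k + i" "k + i + N"] by (simp add: G_def) (meson mult_right_mono order_trans)
    qed
    ultimately show False
      by (simp add: algebra_simps)
  qed
  have "(\<lambda>i. measure lborel (V i)) \<longlonglongrightarrow> measure lborel (\<Inter>i. V i)"
  proof (rule Lim_measure_decseq)
    show "decseq V"
      by (force simp: decseq_def V_def)
  qed (use V_fm in \<open>auto simp: fmeasurable_def less_top\<close>)
  then have "K * s \<le> measure lborel (\<Inter>i. V i)"
    by (rule LIMSEQ_le_const) (use V in auto)
  also have "(\<Inter>i. V i) = {x. \<exists>\<^sub>\<infinity>n. x \<in> E n}"
  proof (intro Set.set_eqI iffI)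
    fix x assume x: "x \<in> (\<Inter>i. V i)"
    have "\<exists>n\<ge>m. x \<in> E n" for m
    proof -
      have "x \<in> V m" using x by blast
      then obtain n where "n \<ge> k + m" "x \<in> E n"
        by (auto simp: V_def)
      then show ?thesis by (intro exI[of _ n]) simp
    qed
    then show "x \<in> {x. \<exists>\<^sub>\<infinity>n. x \<in> E n}"
      by (simp add: INFM_nat_le)
  qed (auto simp: INFM_nat_le V_def)
  finally show ?thesis
    by (simp add: E_def r_def)
qed

section \<open>Full measure from local lower bounds\<close>

text \<open>
  A density argument by Vitali covering. If \<open>X - E\<close> had positive measure, one could cover it
  up to a null set by disjoint balls inside an open set that is only slightly larger, by a factor less
  than \<open>1 + c\<close>. But \<open>E\<close> occupies the proportion \<open>c\<close> of these balls.
\<close>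

lemma negligible_Diff_if_locally_large:
  fixes X E :: "'a :: euclidean_space set"
  assumes B: "X - E \<in> lmeasurable" and E: "E \<in> sets lebesgue" and "0 < c"
    and large: "\<And>x d. x \<in> X \<Longrightarrow> 0 < d \<Longrightarrow> \<exists>a r. 0 < r \<and> r < d \<and> x \<in> cball a r \<and>
      ennreal c * emeasure lebesgue (cball a r) \<le> emeasure lebesgue (E \<inter> cball a r)"
  shows "negligible (X - E)"
proof (rule ccontr)
  assume neg: "\<not> negligible (X - E)"
  let ?b = "measure lebesgue (X - E)"
  have "?b \<noteq> 0"
    using neg B by (simp add: negligible_iff_measure)
  then have b: "0 < ?b"
    by (simp add: zero_less_measure_iff)
  obtain U where U: "open U" "X - E \<subseteq> U" "U - (X - E) \<in> lmeasurable"
    "emeasure lebesgue (U - (X - E)) < ennreal (c * ?b)"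
    using sets_lebesgue_outer_open[of "X - E" "c * ?b"] B b \<open>0 < c\<close> by (auto simp: fmeasurable_def)
  have U_eq: "U = (X - E) \<union> (U - (X - E))"
    using U(2) by blast
  have Um: "U \<in> lmeasurable"
    by (subst U_eq) (use U(3) B in \<open>rule fmeasurable.Un[rotated]\<close>)
  have "measure lebesgue U \<le> ?b + measure lebesgue (U - (X - E))"
    by (subst (1) U_eq) (use U(3) B in \<open>intro measure_Un_le; auto simp: fmeasurable_def\<close>)
  moreover have "measure lebesgue (U - (X - E)) < c * ?b"
    using U(3,4) b \<open>0 < c\<close> by (simp add: emeasure_eq_measure2 ennreal_less_iff)
  ultimately have U_less: "measure lebesgue U < ?b + c * ?b"
    by linarith
  define K where "K = {(a, r). 0 < r \<and> cball a r \<subseteq> U \<and>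
      ennreal c * emeasure lebesgue (cball a r) \<le> emeasure lebesgue (E \<inter> cball a r)}"
  have r_pos: "0 < snd i" if "i \<in> K" for i
    using that by (auto simp: K_def)
  have "\<exists>i. i \<in> K \<and> x \<in> cball (fst i) (snd i) \<and> snd i < d" if x: "x \<in> X - E" and "0 < d" for x d
  proof -
    obtain e where e: "0 < e" "ball x e \<subseteq> U"
      using U(1,2) x by (meson open_contains_ball subsetD)
    obtain a r where ar: "0 < r" "r < min d (e / 2)" "x \<in> cball a r"
      "ennreal c * emeasure lebesgue (cball a r) \<le> emeasure lebesgue (E \<inter> cball a r)"
      using large[of x "min d (e / 2)"] x e(1) \<open>0 < d\<close> by auto
    have "cball a r \<subseteq> ball x e"
    proof
      fix y assume "y \<in> cball a r"
      then have "dist x y \<le> r + r"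
        using ar(3) dist_triangle[of x y a] by (simp add: dist_commute)
      then show "y \<in> ball x e"
        using ar(2) by simp
    qed
    then show ?thesis
      using ar e(2) by (intro exI[of _ "(a, r)"]) (auto simp: K_def)
  qed
  note Vitali_covering_theorem_cballs[of K snd "X - E" fst, OF r_pos this]
  then obtain C where C: "countable C" "C \<subseteq> K"
    "pairwise (\<lambda>i j. disjnt (cball (fst i) (snd i)) (cball (fst j) (snd j))) C"
    "negligible (X - E - (\<Union>i\<in>C. cball (fst i) (snd i)))"
    by blast
  define J where "J i = cball (fst i) (snd i)" for i :: "'a \<times> real"
  define V where "V = (\<Union>i\<in>C. J i)"
  have J: "J i \<in> sets lebesgue" for i
    by (simp add: J_def)
  have disj: "disjoint_family_on J C"
    using C(3) by (auto simp: disjoint_family_on_def pairwise_def disjnt_def J_def)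
  have "ennreal c * emeasure lebesgue V = (\<integral>\<^sup>+i. ennreal c * emeasure lebesgue (J i) \<partial>count_space C)"
    unfolding V_def using C(1) disj J by (simp add: emeasure_UN_countable nn_integral_cmult)
  also have "\<dots> \<le> (\<integral>\<^sup>+i. emeasure lebesgue (E \<inter> J i) \<partial>count_space C)"
    using C(2) by (intro nn_integral_mono) (auto simp: K_def J_def)
  also have "\<dots> = emeasure lebesgue (\<Union>i\<in>C. E \<inter> J i)"
  proof (rule emeasure_UN_countable[symmetric])
    show "disjoint_family_on (\<lambda>i. E \<inter> J i) C"
      using disj unfolding disjoint_family_on_def by blast
  qed (use C(1) J E in auto)
  also have "(\<Union>i\<in>C. E \<inter> J i) = V \<inter> E"
    by (auto simp: V_def)
  finally have le: "ennreal c * emeasure lebesgue V \<le> emeasure lebesgue (V \<inter> E)" .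
  have "J i \<subseteq> U" if "i \<in> C" for i
    using subsetD[OF C(2) that] by (cases i) (simp add: J_def K_def)
  then have "V \<subseteq> U"
    unfolding V_def by blast
  have V: "V \<in> sets lebesgue"
    unfolding V_def using C(1) J by (intro sets.countable_UN') auto
  have Vm: "V \<in> lmeasurable"
    by (rule fmeasurableI2[OF Um \<open>V \<subseteq> U\<close> V])
  have VE: "V \<inter> E \<in> lmeasurable" "V - E \<in> lmeasurable"
    by (rule fmeasurable_Int_fmeasurable[OF Vm E], rule fmeasurable_Diff[OF Vm E])
  have "ennreal (c * measure lebesgue V) \<le> ennreal (measure lebesgue (V \<inter> E))"
    using le Vm VE(1) \<open>0 < c\<close> by (simp add: emeasure_eq_measure2 ennreal_mult)
  then have 1: "c * measure lebesgue V \<le> measure lebesgue (V \<inter> E)"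
    by (simp add: ennreal_le_iff)
  have "?b \<le> measure lebesgue ((V - E) \<union> (X - E - V))"
    using C(4) VE(2) B by (intro measure_mono_fmeasurable fmeasurable.Un)
      (auto simp: V_def J_def negligible_iff_measure)
  also have "\<dots> \<le> measure lebesgue (V - E) + measure lebesgue (X - E - V)"
    using C(4) VE(2) by (intro measure_Un_le) (auto simp: V_def J_def negligible_iff_measure)
  also have "measure lebesgue (X - E - V) = 0"
    using C(4) by (simp add: V_def J_def negligible_iff_measure)
  finally have 2: "?b \<le> measure lebesgue (V - E)"
    by simp
  have 3: "measure lebesgue V = measure lebesgue (V \<inter> E) + measure lebesgue (V - E)"
    using measurable_measure_Diff[OF Vm, of "V \<inter> E"] VE(1) by (simp add: fmeasurable_def Diff_Int)
  have "measure lebesgue V \<le> measure lebesgue U"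
    using \<open>V \<subseteq> U\<close> V Um by (rule measure_mono_fmeasurable)
  moreover have "?b \<le> measure lebesgue V"
    using 2 3 measure_nonneg[of lebesgue "V \<inter> E"] by linarith
  then have "c * ?b \<le> c * measure lebesgue V"
    using \<open>0 < c\<close> by simp
  ultimately show False
    using 1 2 3 U_less by linarith
qed

section \<open>Fixed points of the inverse branches\<close>

lemma ifs_inverse_word_eq:
  assumes "0 < l" "w \<in> lists {0, 1}"
  shows "ifs_inverse_word l w x = (x - horner_sum real l w) / l ^ length w"
  using assms(2)
proof (induction w arbitrary: x)
  case (Cons i w)
  have i: "i = 0 \<or> i = 1"
    using Cons.hyps by auto
  have "inj (ifs_map l i)"
    using \<open>0 < l\<close> by (auto simp: inj_on_def ifs_map_def)
  moreover have "ifs_map l i ((x - real i) / l) = x"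
    using i \<open>0 < l\<close> by (auto simp: ifs_map_def)
  ultimately have "inv_into UNIV (ifs_map l i) x = (x - real i) / l"
    by (rule inv_f_eq)
  then have "ifs_inverse_word l (i # w) x = ifs_inverse_word l w ((x - real i) / l)"
    by (simp add: ifs_inverse_word_def)
  also have "\<dots> = ((x - real i) / l - horner_sum real l w) / l ^ length w"
    by (rule Cons.IH)
  also have "\<dots> = (x - horner_sum real l (i # w)) / l ^ length (i # w)"
    using \<open>0 < l\<close> by (simp add: field_simps)
  finally show ?case .
qed (simp add: ifs_inverse_word_def)

definition word_fixpoint :: "real \<Rightarrow> nat list \<Rightarrow> real" where
  "word_fixpoint l w = horner_sum real l w / (1 - l ^ length w)"

text \<open>
  The inverse branch is affine with slope \<open>1 / l ^ n\<close> and fixes \<open>word_fixpoint l w\<close>, so it displaces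
  \<open>x\<close> by \<open>1 / l ^ n - 1\<close> times the distance to the fixed point.
\<close>

lemma ifs_inverse_word_near_fixpoint:
  assumes l: "0 < l" "l < 1" and w: "w \<in> lists {0, 1}" "w \<noteq> []"
    and near: "\<bar>x - word_fixpoint l w\<bar> \<le> r / 2 ^ length w"
  shows "ifs_inverse_word l w x \<in> cball x (r / (2 * l) ^ length w)"
proof -
  let ?n = "length w"
  have n: "0 < 1 - l ^ ?n" "0 < l ^ ?n"
    using l w(2) by (simp_all add: power_less_one_iff)
  have "r / 2 ^ ?n \<ge> 0"
    using near by linarith
  have "ifs_inverse_word l w x - x = (1 - l ^ ?n) / l ^ ?n * (x - word_fixpoint l w)"
  proof -
    have "(1 - l ^ ?n) * word_fixpoint l w = horner_sum real l w"
      using n by (simp add: word_fixpoint_def)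
    then have "(1 - l ^ ?n) * (x - word_fixpoint l w) = x - horner_sum real l w - l ^ ?n * x"
      by (simp add: algebra_simps)
    then have "(1 - l ^ ?n) / l ^ ?n * (x - word_fixpoint l w) = (x - horner_sum real l w - l ^ ?n * x) / l ^ ?n"
      by (simp only: times_divide_eq_left)
    also have "\<dots> = (x - horner_sum real l w) / l ^ ?n - x"
      using l(1) by (simp add: diff_divide_distrib)
    finally show ?thesis
      unfolding ifs_inverse_word_eq[OF l(1) w(1)] by (rule sym)
  qed
  then have "\<bar>ifs_inverse_word l w x - x\<bar> = (1 - l ^ ?n) / l ^ ?n * \<bar>x - word_fixpoint l w\<bar>"
    using n by (simp add: abs_mult)
  also have "\<dots> \<le> 1 / l ^ ?n * (r / 2 ^ ?n)"
    using n near by (intro mult_mono divide_right_mono) auto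
  finally show ?thesis
    by (simp add: dist_real_def power_mult_distrib abs_minus_commute mult.commute)
qed

lemma horner_sum_binary_bounds:
  assumes "0 < l" "l < 1" "w \<in> lists {0, 1}"
  shows "0 \<le> horner_sum real l w" "horner_sum real l w \<le> 1 / (1 - l)"
proof -
  have "0 \<le> horner_sum real l w \<and> horner_sum real l w \<le> 1 / (1 - l)"
    using assms(3)
  proof (induction w)
    case (Cons i w)
    have "real i \<le> 1"
      using Cons.hyps by auto
    moreover have "l * horner_sum real l w \<le> l * (1 / (1 - l))"
      using Cons.IH assms(1) by (intro mult_left_mono) auto
    moreover have "1 + l * (1 / (1 - l)) = 1 / (1 - l)"
      using assms by (simp add: field_simps)
    ultimately show ?case
      using Cons.IH assms by simp
  qed (use assms in simp)
  then show "0 \<le> horner_sum real l w" "horner_sum real l w \<le> 1 / (1 - l)"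
    by auto
qed

text \<open>
  Since \<open>1 / 2 < l\<close>, the images of \<open>[0, 1 / (1 - l)]\<close> under the two maps cover this interval; the
  digits are found greedily.
\<close>

lemma exists_cylinder_containing:
  assumes "1 / 2 < l" "l < 1" "x \<in> {0..1 / (1 - l)}"
  obtains w where "w \<in> lists {0, 1}" "length w = n"
    "x \<in> {horner_sum real l w..horner_sum real l w + l ^ n / (1 - l)}"
proof -
  have "\<exists>w \<in> lists {0, 1}. length w = n \<and> x \<in> {horner_sum real l w..horner_sum real l w + l ^ n / (1 - l)}"
    using assms(3)
  proof (induction n arbitrary: x)
    case 0
    then show ?case
      by (intro bexI[of _ "[]"]) auto
  next
    case (Suc n)
    define i :: nat where "i = (if x \<le> l / (1 - l) then 0 else 1)"
    have "1 \<le> l / (1 - l)"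
      using assms by (simp add: field_simps)
    moreover have "l / (1 - l) = 1 / (1 - l) - 1"
      using assms by (simp add: field_simps)
    ultimately have "0 \<le> x - real i" "x - real i \<le> l / (1 - l)"
      using Suc.prems by (auto simp: i_def)
    then have "(x - real i) / l \<in> {0..1 / (1 - l)}"
      using assms by (simp add: field_simps)
    then obtain w where w: "w \<in> lists {0, 1}" "length w = n"
      "horner_sum real l w \<le> (x - real i) / l" "(x - real i) / l \<le> horner_sum real l w + l ^ n / (1 - l)"
      using Suc.IH[of "(x - real i) / l"] by auto
    have "l * horner_sum real l w \<le> x - real i"
      using w(3) assms(1) by (simp add: field_simps)
    moreover have "x - real i \<le> l * (horner_sum real l w + l ^ n / (1 - l))"
      using w(4) assms(1) by (simp add: pos_divide_le_eq mult.commute)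
    moreover have "l * (horner_sum real l w + l ^ n / (1 - l)) = l * horner_sum real l w + l ^ Suc n / (1 - l)"
      by (simp add: distrib_left)
    ultimately have "x \<in> {horner_sum real l (i # w)..horner_sum real l (i # w) + l ^ Suc n / (1 - l)}"
      by simp
    moreover have "i # w \<in> lists {0, 1}" "length (i # w) = Suc n"
      using w(1,2) by (simp_all add: i_def)
    ultimately show ?case
      by blast
  qed
  then show thesis
    using that by blast
qed

lemma word_fixpoint_bounds:
  assumes "0 < l" "l < 1" "w \<in> lists {0, 1}" "w \<noteq> []"
  shows "horner_sum real l w \<le> word_fixpoint l w"
    "word_fixpoint l w \<le> horner_sum real l w + l ^ length w / (1 - l)\<^sup>2"
proof -
  let ?s = "horner_sum real l w" and ?q = "l ^ length w"
  have q: "0 < ?q" "?q \<le> l"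
    using assms power_decreasing[of 1 "length w" l] by (auto simp: Suc_le_eq)
  have s: "0 \<le> ?s" "?s \<le> 1 / (1 - l)"
    using horner_sum_binary_bounds[OF assms(1-3)] by auto
  have eq: "word_fixpoint l w = ?s + ?s * ?q / (1 - ?q)"
    using q assms(2) by (simp add: word_fixpoint_def field_simps)
  show "?s \<le> word_fixpoint l w"
    unfolding eq using q s assms(2) by simp
  have "?s * ?q / (1 - ?q) \<le> (1 / (1 - l)) * ?q / (1 - l)"
    using q s assms by (intro frac_le mult_right_mono mult_nonneg_nonneg) auto
  then show "word_fixpoint l w \<le> ?s + ?q / (1 - l)\<^sup>2"
    unfolding eq by (simp add: power2_eq_square)
qed

text \<open>
  The fixed points inherit the separation of the sums, as they arise from them by division by a
  common number at most 1.
\<close>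

lemma word_fixpoint_separated:
  assumes "0 < l" "l < 1" "length u = length v" "u \<noteq> []"
  shows "\<bar>horner_sum real l u - horner_sum real l v\<bar> \<le> \<bar>word_fixpoint l u - word_fixpoint l v\<bar>"
proof -
  have q: "0 < 1 - l ^ length v" "1 - l ^ length v \<le> 1"
    using assms by (auto simp: power_less_one_iff)
  have "\<bar>word_fixpoint l u - word_fixpoint l v\<bar> = \<bar>horner_sum real l u - horner_sum real l v\<bar> / (1 - l ^ length v)"
    using q assms(3) by (simp add: word_fixpoint_def flip: diff_divide_distrib)
  also have "\<dots> \<ge> \<bar>horner_sum real l u - horner_sum real l v\<bar>"
    using q by (simp add: pos_le_divide_eq mult_left_le)
  finally show ?thesis .
qed

definition binary_words :: "nat \<Rightarrow> nat list set" where
  "binary_words n = {w \<in> lists {0, 1}. length w = n}"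

lemma card_binary_words: "card (binary_words n) = 2 ^ n"
  and finite_binary_words: "finite (binary_words n)"
proof -
  have *: "binary_words n = {w. set w \<subseteq> {0, 1} \<and> length w = n}"
    by (auto simp: binary_words_def lists_eq_set)
  show "card (binary_words n) = 2 ^ n"
    unfolding * by (subst card_lists_length_eq) (auto simp: numeral_2_eq_2)
  show "finite (binary_words n)"
    unfolding * by (rule finite_lists_length_eq) simp
qed

definition near_fixpoints :: "real \<Rightarrow> (nat \<Rightarrow> real) \<Rightarrow> nat \<Rightarrow> real set" where
  "near_fixpoints l g n = (\<Union>w\<in>binary_words n. cball (word_fixpoint l w) (g n / 2 ^ n))"

lemma sets_infinitely_often:
  assumes "\<And>n. A n \<in> sets M"
  shows "{x. \<exists>\<^sub>\<infinity>n :: nat. x \<in> A n} \<in> sets M"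
proof -
  have "{x. \<exists>\<^sub>\<infinity>n. x \<in> A n} = (\<Inter>m. \<Union>n\<in>{m..}. A n)"
    by (simp add: set_eq_iff INFM_nat_le Bex_def)
  then show ?thesis
    using assms by (simp add: sets.countable_INT sets.countable_UN' image_subset_iff)
qed

lemma Limsup_near_fixpoints_measurable: "{x. \<exists>\<^sub>\<infinity>n. x \<in> near_fixpoints l g n} \<in> sets borel"
  unfolding near_fixpoints_def
  by (intro sets_infinitely_often sets.finite_UN finite_binary_words) auto

section \<open>Recurrent points in cylinder intervals\<close>

text \<open>
  The fixed points of the words of length \<open>n\<close> with prefix \<open>w\<close> number \<open>2 ^ n / 2 ^ k\<close> and are
  separated by \<open>\<delta> * (2 * l) ^ k / 2 ^ n\<close>, where \<open>k\<close> is the length of \<open>w\<close>: prepending \<open>w\<close> contracts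
  differences by \<open>l ^ k\<close> only, while the remaining words are shorter by \<open>k\<close>. The product of the two
  constants is \<open>\<delta> * l ^ k\<close>. As \<open>n\<close> grows, these fixed points and the balls around them approach the
  cylinder interval of \<open>w\<close>, so the limsup of the balls lies in that closed interval.
\<close>

lemma Limsup_near_fixpoints_cylinder:
  assumes l: "1 / 2 < l" "l < 1" and "0 < \<delta>"
    and sep: "\<And>u v. u \<in> lists {0, 1} \<Longrightarrow> v \<in> lists {0, 1} \<Longrightarrow> length u = length v \<Longrightarrow> u \<noteq> v \<Longrightarrow>
      \<delta> / 2 ^ length u \<le> \<bar>horner_sum real l u - horner_sum real l v\<bar>"
    and g: "\<And>n. 0 \<le> g n" "\<And>n. g n \<le> \<delta> / 3" "\<not> summable g"
    and w: "w \<in> lists {0, 1}"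
  shows "\<delta> * l ^ length w \<le> measure lborel ({x. \<exists>\<^sub>\<infinity>n. x \<in> near_fixpoints l g n} \<inter>
    {horner_sum real l w..horner_sum real l w + l ^ length w / (1 - l)})" (is "_ \<le> measure lborel (?E \<inter> ?J)")
proof -
  define k where "k = length w"
  define W where "W n = (@) w ` binary_words (n - k)" for n
  define P where "P n = word_fixpoint l ` W n" for n
  define s where "s = \<delta> * (2 * l) ^ k"
  have W: "u \<in> lists {0, 1}" "length u = n" "u \<noteq> []" "horner_sum real l u \<in> ?J"
    if "u \<in> W n" "Suc k \<le> n" for u n
  proof -
    from that(1) obtain v where v: "v \<in> lists {0, 1}" "length v = n - k" "u = w @ v"
      unfolding W_def binary_words_def by blast
    show "u \<in> lists {0, 1}"
      using v(1) w unfolding v(3) by (simp only: append_in_lists_conv)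
    show len: "length u = n"
      using v(2) that(2) by (simp add: v(3) k_def)
    show "u \<noteq> []"
      using len that(2) by force
    have "0 \<le> l ^ length w * horner_sum real l v"
      using horner_sum_binary_bounds(1)[OF _ l(2) v(1)] l by simp
    moreover have "l ^ length w * horner_sum real l v \<le> l ^ length w * (1 / (1 - l))"
      using horner_sum_binary_bounds(2)[OF _ l(2) v(1)] l by (intro mult_left_mono) simp_all
    ultimately show "horner_sum real l u \<in> ?J"
      by (simp add: v(3) horner_sum_append)
  qed
  have sepW: "s / 2 ^ n \<le> \<bar>word_fixpoint l u - word_fixpoint l u'\<bar>"
    if n: "Suc k \<le> n" and u: "u \<in> W n" "u' \<in> W n" "u \<noteq> u'" for n u u'
  proof -
    obtain v where v: "v \<in> lists {0, 1}" "length v = n - k" "u = w @ v"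
      using u(1) unfolding W_def binary_words_def by blast
    obtain v' where v': "v' \<in> lists {0, 1}" "length v' = n - k" "u' = w @ v'"
      using u(2) unfolding W_def binary_words_def by blast
    have "(2 :: real) ^ n = 2 ^ k * 2 ^ (n - k)"
      using n by (simp flip: power_add)
    then have "s / 2 ^ n = l ^ k * (\<delta> / 2 ^ length v)"
      by (simp add: s_def v(2) power_mult_distrib)
    also have "\<dots> \<le> l ^ k * \<bar>horner_sum real l v - horner_sum real l v'\<bar>"
      using v v' u(3) l by (intro mult_left_mono sep) auto
    also have "\<dots> = \<bar>horner_sum real l u - horner_sum real l u'\<bar>"
      using l by (simp add: v(3) v'(3) horner_sum_append k_def abs_mult flip: right_diff_distrib)
    also have "\<dots> \<le> \<bar>word_fixpoint l u - word_fixpoint l u'\<bar>"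
      using W[OF u(1) n] W[OF u(2) n] l by (intro word_fixpoint_separated) auto
    finally show ?thesis .
  qed
  have "0 < s"
    using \<open>0 < \<delta>\<close> l by (simp add: s_def)
  have "\<delta> \<le> s"
    using \<open>0 < \<delta>\<close> l one_le_power[of "2 * l" k] by (simp add: s_def mult_le_cancel_left1)
  have "1 / 2 ^ k * s \<le> measure lborel {x. \<exists>\<^sub>\<infinity>n. x \<in> (\<Union>p\<in>P n. cball p (g n / 2 ^ n))}"
    \<comment> \<open>Starting at \<open>k + 1\<close> keeps all words nonempty also for \<open>k = 0\<close>; the empty word acts as the
      identity and has no isolated fixed point.\<close>
  proof (rule measure_Limsup_separated_balls[where k = "Suc k" and a = 0 and b = "1 / (1 - l) + 1 / (1 - l)\<^sup>2"])
    fix n assume n: "Suc k \<le> n"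
    have "inj_on (word_fixpoint l) (W n)"
    proof (rule inj_onI, rule ccontr)
      fix u u' assume "u \<in> W n" "u' \<in> W n" "word_fixpoint l u = word_fixpoint l u'" "u \<noteq> u'"
      moreover have "0 < s / 2 ^ n"
        using \<open>0 < s\<close> by simp
      ultimately show False
        using sepW[OF n, of u u'] by simp
    qed
    then have "card (P n) = card (binary_words (n - k))"
      by (simp add: P_def W_def card_image inj_on_def)
    then show "real (card (P n)) = 1 / 2 ^ k * 2 ^ n"
      using n by (simp add: card_binary_words power_diff[of "2 :: real"])
    show "finite (P n)"
      by (simp add: P_def W_def finite_binary_words)
    show "s / 2 ^ n \<le> \<bar>p - q\<bar>" if "p \<in> P n" "q \<in> P n" "p \<noteq> q" for p q
      using that sepW[OF n] by (auto simp: P_def)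
    show "P n \<subseteq> {0..1 / (1 - l) + 1 / (1 - l)\<^sup>2}"
    proof
      fix p assume "p \<in> P n"
      then obtain u where u: "u \<in> W n" "p = word_fixpoint l u"
        by (auto simp: P_def)
      note uW = W[OF u(1) n]
      have "l ^ length u / (1 - l)\<^sup>2 \<le> 1 / (1 - l)\<^sup>2"
        using l by (intro divide_right_mono power_le_one) auto
      then show "p \<in> {0..1 / (1 - l) + 1 / (1 - l)\<^sup>2}"
        using word_fixpoint_bounds[OF _ l(2) uW(1,3)] horner_sum_binary_bounds[OF _ l(2) uW(1)] l u(2) by auto
    qed
  next
    show "g n \<le> s / 3" for n
      using g(2)[of n] \<open>\<delta> \<le> s\<close> by simp
  qed (use \<open>0 < s\<close> g in auto)
  also have "1 / 2 ^ k * s = \<delta> * l ^ length w"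
    by (simp add: s_def k_def power_mult_distrib)
  also have "measure lborel {x. \<exists>\<^sub>\<infinity>n. x \<in> (\<Union>p\<in>P n. cball p (g n / 2 ^ n))} \<le> measure lborel (?E \<inter> ?J)"
  proof (rule measure_mono_fmeasurable)
    show "?E \<inter> ?J \<in> fmeasurable lborel"
    proof (rule fmeasurableI2[of ?J])
      show "?J \<in> fmeasurable lborel"
        by (intro fmeasurable_compact) simp
    qed (use Limsup_near_fixpoints_measurable[of l g] in auto)
    show "{x. \<exists>\<^sub>\<infinity>n. x \<in> (\<Union>p\<in>P n. cball p (g n / 2 ^ n))} \<in> sets lborel"
      by (intro sets_infinitely_often sets.finite_UN) (auto simp: P_def W_def finite_binary_words)
    show "{x. \<exists>\<^sub>\<infinity>n. x \<in> (\<Union>p\<in>P n. cball p (g n / 2 ^ n))} \<subseteq> ?E \<inter> ?J"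
    proof
      fix x assume "x \<in> {x. \<exists>\<^sub>\<infinity>n. x \<in> (\<Union>p\<in>P n. cball p (g n / 2 ^ n))}"
      then have x: "\<exists>\<^sub>\<infinity>n. x \<in> (\<Union>p\<in>P n. cball p (g n / 2 ^ n))"
        by simp
      then have x': "\<exists>\<^sub>\<infinity>n. x \<in> (\<Union>p\<in>P n. cball p (g n / 2 ^ n)) \<and> Suc k \<le> n"
        using MOST_ge_nat by (rule INFM_conjI)
      have "\<exists>\<^sub>\<infinity>n. x \<in> near_fixpoints l g n"
        using x'
      proof (rule INFM_mono)
        fix n assume n: "x \<in> (\<Union>p\<in>P n. cball p (g n / 2 ^ n)) \<and> Suc k \<le> n"
        then obtain u where "u \<in> W n" "x \<in> cball (word_fixpoint l u) (g n / 2 ^ n)"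
          by (auto simp: P_def)
        then show "x \<in> near_fixpoints l g n"
          using W(1,2)[of u n] n unfolding near_fixpoints_def binary_words_def by blast
      qed
      moreover have "x \<in> ?J"
      proof -
        \<comment> \<open>Radius of the ball plus distance of the fixed point of \<open>u\<close> from \<open>horner_sum real l u\<close>, which
          lies in the interval.\<close>
        define e where "e n = \<delta> / 3 / 2 ^ n + l ^ n / (1 - l)\<^sup>2" for n
        have often: "\<exists>\<^sub>\<infinity>n. infdist x ?J \<le> e n"
          using x'
        proof (rule INFM_mono)
          fix n assume n: "x \<in> (\<Union>p\<in>P n. cball p (g n / 2 ^ n)) \<and> Suc k \<le> n"
          then obtain u where u: "u \<in> W n" "x \<in> cball (word_fixpoint l u) (g n / 2 ^ n)"
            by (auto simp: P_def)
          note uW = W[OF u(1) conjunct2[OF n]]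
          have "infdist x ?J \<le> dist x (horner_sum real l u)"
            using uW(4) by (rule infdist_le)
          also have "\<dots> \<le> \<bar>x - word_fixpoint l u\<bar> + \<bar>word_fixpoint l u - horner_sum real l u\<bar>"
            by (simp add: dist_real_def)
          also have "\<bar>x - word_fixpoint l u\<bar> \<le> g n / 2 ^ n"
            using u(2) by (simp add: dist_real_def abs_minus_commute)
          also have "g n / 2 ^ n \<le> \<delta> / 3 / 2 ^ n"
            using g(2)[of n] by (intro divide_right_mono) auto
          also have "\<bar>word_fixpoint l u - horner_sum real l u\<bar> \<le> l ^ n / (1 - l)\<^sup>2"
            using word_fixpoint_bounds[OF _ l(2) uW(1,3)] l uW(2) by auto
          finally show "infdist x ?J \<le> e n"
            by (simp add: e_def)
        qed
        have "e \<longlonglongrightarrow> 0"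
        proof -
          have "(\<lambda>n. \<delta> / 3 * (1 / 2) ^ n + l ^ n / (1 - l)\<^sup>2) \<longlonglongrightarrow> \<delta> / 3 * 0 + 0 / (1 - l)\<^sup>2"
            using l by (intro tendsto_intros LIMSEQ_power_zero) auto
          then show ?thesis
            by (simp add: e_def[abs_def] power_one_over)
        qed
        have False if "0 < infdist x ?J"
        proof -
          have "\<forall>\<^sub>F n in sequentially. e n < infdist x ?J"
            using \<open>e \<longlonglongrightarrow> 0\<close> that by (rule order_tendstoD(2))
          then obtain N where "\<And>n. N \<le> n \<Longrightarrow> e n < infdist x ?J"
            by (auto simp: eventually_sequentially)
          with often show False
            unfolding INFM_nat_le by (meson not_le)
        qed
        then have "infdist x ?J = 0"
          using infdist_nonneg[of x ?J] by fastforce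
        moreover have "?J \<noteq> {}"
          using l by simp
        ultimately show "x \<in> ?J"
          using in_closed_iff_infdist_zero[of ?J x] by simp
      qed
      ultimately show "x \<in> ?E \<inter> ?J"
        by simp
    qed
  qed
  finally show ?thesis .
qed

text \<open>
  If the truncated series converged, its terms would tend to 0 and truncation would eventually do
  nothing.
\<close>

lemma not_summable_min:
  fixes f :: "nat \<Rightarrow> real"
  assumes "\<not> summable f" "0 < c"
  shows "\<not> summable (\<lambda>n. min (f n) c)"
proof
  assume summ: "summable (\<lambda>n. min (f n) c)"
  then have "\<forall>\<^sub>F n in sequentially. min (f n) c < c"
    using summable_LIMSEQ_zero order_tendstoD(2) \<open>0 < c\<close> by blast
  then have "\<forall>\<^sub>F n in sequentially. min (f n) c = f n"
    by eventually_elim auto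
  then have "summable f"
    using summ by (rule iffD1[OF summable_cong])
  with assms(1) show False
    by contradiction
qed

theorem theorem2p5:
  fixes l :: real and h :: "nat \<Rightarrow> real"
  assumes "1 / 2 < l" and "l < 1"
    and "garsia_number (inverse l)"
    and "\<And>n. n \<ge> 1 \<Longrightarrow> h n \<ge> 0"
    and "(\<Sum>n. ennreal (h (Suc n))) = \<infinity>"
  shows "AE x in lebesgue. x \<in> {0..1 / (1 - l)} \<longrightarrow> x \<in> recurrence_set l h"
proof -
  have "0 < l"
    using assms(1) by simp
  obtain \<delta> where \<delta>: "0 < \<delta>"
    "\<And>u v. u \<in> lists {0, 1} \<Longrightarrow> v \<in> lists {0, 1} \<Longrightarrow> length u = length v \<Longrightarrow> u \<noteq> v \<Longrightarrow>
      \<delta> / 2 ^ length u \<le> \<bar>horner_sum real l u - horner_sum real l v\<bar>"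
    using garsia_separation[OF assms(3) \<open>0 < l\<close>] by metis
  \<comment> \<open>Only the values of \<open>h\<close> from 1 on are known to be nonnegative; at 0 the value 0 is used. The bound
    \<open>\<delta> / 3\<close> makes the balls of one generation disjoint.\<close>
  define g where "g n = min (if n = 0 then 0 else h n) (\<delta> / 3)" for n
  have g: "0 \<le> g n" "g n \<le> \<delta> / 3" for n
    using assms(4)[of n] \<delta>(1) by (auto simp: g_def)
  have "\<not> summable (\<lambda>n. h (Suc n))"
    using suminf_ennreal2[of "\<lambda>n. h (Suc n)"] assms(4,5) by auto
  then have "\<not> summable (\<lambda>n. if n = 0 then 0 else h n)"
    using summable_Suc_iff[of "\<lambda>n. if n = 0 then 0 else h n"] by simp
  then have g_div: "\<not> summable g"
    unfolding g_def using \<delta>(1) by (intro not_summable_min) auto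
  define E where "E = {x. \<exists>\<^sub>\<infinity>n. x \<in> near_fixpoints l g n}"
  define X where "X = {0..1 / (1 - l)}"
  have E: "E \<in> sets borel"
    unfolding E_def by (rule Limsup_near_fixpoints_measurable)
  have "negligible (X - E)"
  proof (rule negligible_Diff_if_locally_large)
    show "E \<in> sets lebesgue"
      using E by simp
    then show "X - E \<in> lmeasurable"
      unfolding X_def by (intro fmeasurable_Diff lmeasurable_interval)
    show "0 < \<delta> * (1 - l)"
      using \<delta>(1) assms(2) by simp
    fix x d :: real
    assume x: "x \<in> X" and "0 < d"
    have "(\<lambda>n. l ^ n / (1 - l) / 2) \<longlonglongrightarrow> 0 / (1 - l) / 2"
      using assms(1,2) by (intro tendsto_divide LIMSEQ_power_zero tendsto_const) auto
    then have "\<forall>\<^sub>F n in sequentially. l ^ n / (1 - l) / 2 < d"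
      using \<open>0 < d\<close> by (simp add: order_tendstoD(2))
    then obtain n where n: "l ^ n / (1 - l) / 2 < d"
      using eventually_happens'[OF sequentially_bot] by blast
    obtain w where w: "w \<in> lists {0, 1}" "length w = n"
      "x \<in> {horner_sum real l w..horner_sum real l w + l ^ n / (1 - l)}"
      by (rule exists_cylinder_containing[OF assms(1,2) x[unfolded X_def], of n])
    define r where "r = l ^ n / (1 - l) / 2"
    define a where "a = horner_sum real l w + r"
    have r2: "l ^ n / (1 - l) = 2 * r"
      by (simp only: r_def mult_2 field_sum_of_halves)
    have ball: "{horner_sum real l w..horner_sum real l w + l ^ n / (1 - l)} = cball a r"
      unfolding r2 by (simp add: cball_eq_atLeastAtMost a_def)
    have r: "0 < r"
      using assms(2) \<open>0 < l\<close> by (simp add: r_def)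
    have "emeasure lebesgue (cball a r) = ennreal (l ^ n / (1 - l))"
      using r unfolding r2 by (simp add: cball_eq_atLeastAtMost)
    then have "ennreal (\<delta> * (1 - l)) * emeasure lebesgue (cball a r) = ennreal (\<delta> * (1 - l) * (l ^ n / (1 - l)))"
      using \<delta>(1) assms(2) by (subst ennreal_mult') simp_all
    also have "\<delta> * (1 - l) * (l ^ n / (1 - l)) = \<delta> * l ^ n"
      using assms(2) by simp
    also have "ennreal (\<delta> * l ^ n) \<le> ennreal (measure lborel (E \<inter> cball a r))"
      using Limsup_near_fixpoints_cylinder[OF assms(1,2) \<delta> g g_div w(1)]
      unfolding w(2) ball E_def[symmetric] by (rule ennreal_leI)
    also have "\<dots> = emeasure lborel (E \<inter> cball a r)"
    proof (rule emeasure_eq_measure2[symmetric])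
      have "cball a r \<inter> E \<in> fmeasurable lborel"
        using E by (intro fmeasurable_Int_fmeasurable fmeasurable_compact) simp_all
      then show "E \<inter> cball a r \<in> fmeasurable lborel"
        by (simp only: Int_commute)
    qed
    also have "\<dots> = emeasure lebesgue (E \<inter> cball a r)"
      using E by simp
    finally show "\<exists>a r. 0 < r \<and> r < d \<and> x \<in> cball a r \<and>
        ennreal (\<delta> * (1 - l)) * emeasure lebesgue (cball a r) \<le> emeasure lebesgue (E \<inter> cball a r)"
      using r n w(3) unfolding ball r_def[symmetric] by (intro exI[of _ a] exI[of _ r] conjI)
  qed
  moreover have "X - recurrence_set l h \<subseteq> X - E"
  proof -
    have "x \<in> recurrence_set l h" if x: "x \<in> X" "x \<in> E" for x
    proof -
      define A where "A = {w \<in> lists {0, 1}. w \<noteq> [] \<and>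
        ifs_inverse_word l w x \<in> cball x (h (length w) / (2 * l) ^ length w)}"
      have "{n. 0 < n \<and> x \<in> near_fixpoints l g n} \<subseteq> length ` A"
      proof
        fix n assume "n \<in> {n. 0 < n \<and> x \<in> near_fixpoints l g n}"
        then obtain w where w: "0 < n" "w \<in> lists {0, 1}" "length w = n"
          "\<bar>x - word_fixpoint l w\<bar> \<le> g n / 2 ^ n"
          by (auto simp: near_fixpoints_def binary_words_def dist_real_def abs_minus_commute)
        have "g n / 2 ^ n \<le> h n / 2 ^ n"
          using w(1) by (intro divide_right_mono) (auto simp: g_def)
        then have "ifs_inverse_word l w x \<in> cball x (h (length w) / (2 * l) ^ length w)"
          using w assms(2) \<open>0 < l\<close> by (intro ifs_inverse_word_near_fixpoint) auto
        then show "n \<in> length ` A"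
          using w by (auto simp: A_def)
      qed
      moreover have "infinite {n. 0 < n \<and> x \<in> near_fixpoints l g n}"
      proof -
        have "\<exists>\<^sub>\<infinity>n. x \<in> near_fixpoints l g n"
          using x(2) by (simp add: E_def)
        then have "\<exists>\<^sub>\<infinity>n. x \<in> near_fixpoints l g n \<and> 1 \<le> n"
          using MOST_ge_nat by (rule INFM_conjI)
        then show ?thesis
          by (simp add: frequently_cofinite conj_commute Suc_le_eq)
      qed
      ultimately have "infinite A"
        by (meson finite_imageI finite_subset)
      with x(1) show ?thesis
        by (simp add: recurrence_set_def X_def A_def)
    qed
    then show ?thesis
      by blast
  qed
  ultimately have "negligible (X - recurrence_set l h)"
    by (rule negligible_subset)
  then have "X - recurrence_set l h \<in> null_sets lebesgue"
    by (simp add: negligible_iff_null_sets)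
  then show ?thesis
    by (rule AE_I'[of _ lebesgue]) (auto simp: X_def)
qed

end
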